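(* Let $m\ge p\ge 2$ and let $G:(\mathbb{R}^m,0)\to(\mathbb{R}^p,0)$ be a non-constant real analytic map germ with isolated critical value, i.e. $\operatorname{Disc}G=\{0\}$. If $G$ is Thom regular at $V_G$, then for every sufficiently small $\varepsilon>0$ there exists a neighbourhood $N_\varepsilon$ of $S^{m-1}_\varepsilon\cap V_G$ in $S^{m-1}_\varepsilon$ such that for every $x\in N_\varepsilon\setminus V_G$ the sphere $S^{m-1}_\varepsilon$ and the fibre $G^{-1}(G(x))$ are transverse at $x$.
   Context: A germ is identified with a representative $G:U\to\mathbb{R}^p$, $U\subseteq\mathbb{R}^m$ an open neighbourhood of $0$, $G(0)=0$. Put $V_G:=G^{-1}(0)$, $\operatorname{Sing}G:=\{x\in U:\operatorname{rank}\,dG(x)\text{ is not maximal}\}$, $\operatorname{Disc}G:=G(\operatorname{Sing}G)$; all sets are considered as germs at the origin. $S^{m-1}_\varepsilon$ and $B^m_\varepsilon$ are the sphere and the open ball of radius $\varepsilon$ centred at $0$ in $\mathbb{R}^m$. Thom regularity when $\operatorname{Disc}G=\{0\}$ (Thom regularity in the classical sense): $G$ is Thom regular at $V_G$ if there are $\varepsilon>0$ and a stratification $\{W_\alpha\}_\alpha$ of $V_G\cap B^m_\varepsilon$ such that $\{B^m_\varepsilon\setminus V_G\}\cup\{W_\alpha\}_\alpha$ is a Whitney stratification of $B^m_\varepsilon$ and, for every $\alpha$, the pair $(B^m_\varepsilon\setminus V_G,W_\alpha)$ satisfies the Thom $(a_G)$-condition: whenever $x\in W_\alpha$ and $\{x_n\}\subset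 B^m_\varepsilon\setminus V_G$ is a sequence converging to $x$ such that $\ker d_{x_n}G=T_{x_n}G^{-1}(G(x_n))$ converges to a linear subspace $\mathcal{T}$ in the Grassmannian, one has $T_xW_\alpha=\ker d_x(G|_{W_\alpha})\subset\mathcal{T}$. *)

theory Defs
  imports "HOL-Analysis.Analysis" "HOL-Library.Disjoint_Sets"
begin

section \<open>Analytic and smooth maps, submanifolds, transversality\<close>

text \<open>Expansion into a multivariate power series around every point; \<^term>\<open>\<alpha> :: 'm \<Rightarrow> nat\<close> is the
  multi-index, and the (unordered) summability in \<^const>\<open>has_sum\<close> is absolute convergence.\<close>

definition real_analytic_on :: "(real ^ 'm) set \<Rightarrow> (real ^ 'm \<Rightarrow> real ^ 'p) \<Rightarrow> bool" where
  "real_analytic_on U f \<longleftrightarrow>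
     (\<forall>a\<in>U. \<exists>r>0. \<exists>c :: ('m \<Rightarrow> nat) \<Rightarrow> real ^ 'p. \<forall>x\<in>ball a r.
        ((\<lambda>\<alpha>. (\<Prod>i\<in>UNIV. (x $ i - a $ i) ^ \<alpha> i) *\<^sub>R c \<alpha>) has_sum f x) UNIV)"

text \<open>The classes \<open>C\<^sup>k\<close> and \<open>C\<^sup>\<infinity>\<close>, meant for open \<^term>\<open>S\<close> only.\<close>

primrec Ck_on :: "nat \<Rightarrow> 'a set \<Rightarrow> ('a::euclidean_space \<Rightarrow> 'b::euclidean_space) \<Rightarrow> bool" where
  "Ck_on 0 S f \<longleftrightarrow> continuous_on S f"
| "Ck_on (Suc k) S f \<longleftrightarrow>
     (\<forall>x\<in>S. f differentiable (at x)) \<and> (\<forall>v. Ck_on k S (\<lambda>x. frechet_derivative f (at x) v))"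

definition smooth_on :: "'a set \<Rightarrow> ('a::euclidean_space \<Rightarrow> 'b::euclidean_space) \<Rightarrow> bool" where
  "smooth_on S f \<longleftrightarrow> (\<forall>k. Ck_on k S f)"

definition smooth_submanifold :: "nat \<Rightarrow> 'a::euclidean_space set \<Rightarrow> bool" where
  "smooth_submanifold d M \<longleftrightarrow>
     (\<forall>x\<in>M. \<exists>U V \<phi> \<psi> L.
        open U \<and> x \<in> U \<and> open V \<and> homeomorphism U V \<phi> \<psi> \<and> smooth_on U \<phi> \<and> smooth_on V \<psi> \<and>
        subspace (L :: 'a set) \<and> dim L = d \<and> \<phi> ` (U \<inter> M) = V \<inter> L)"

definition tangent_space :: "'a \<Rightarrow> 'a::euclidean_space set \<Rightarrow> 'a set" where
  "tangent_space x M =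
     {v. \<exists>e>0. \<exists>\<gamma>. smooth_on {-e<..<e} \<gamma> \<and> \<gamma> ` {-e<..<e} \<subseteq> M \<and> \<gamma> (0::real) = x \<and>
           (\<gamma> has_vector_derivative v) (at 0)}"

definition transverse_at :: "'a::euclidean_space set \<Rightarrow> 'a set \<Rightarrow> 'a \<Rightarrow> bool" where
  "transverse_at M N x \<longleftrightarrow>
     x \<in> M \<inter> N \<and>
     (\<exists>W. open W \<and> x \<in> W \<and> (\<exists>d. smooth_submanifold d (W \<inter> M)) \<and> (\<exists>d. smooth_submanifold d (W \<inter> N))) \<and>
     {u + v | u v. u \<in> tangent_space x M \<and> v \<in> tangent_space x N} = UNIV"

section \<open>Convergence in the Grassmannian\<close>

text \<open>On linear subspaces, \<^const>\<open>closest_point\<close> is the orthogonal projection; the operator norm of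
  the difference of projections metrizes the Grassmannian.\<close>

definition grassmannian :: "nat \<Rightarrow> 'a::euclidean_space set set" where
  "grassmannian d = {L. subspace L \<and> dim L = d}"

definition subspace_dist :: "'a::euclidean_space set \<Rightarrow> 'a set \<Rightarrow> real" where
  "subspace_dist L M = onorm (\<lambda>v. closest_point L v - closest_point M v)"

definition grassmann_tendsto :: "(nat \<Rightarrow> 'a::euclidean_space set) \<Rightarrow> 'a set \<Rightarrow> bool" where
  "grassmann_tendsto L T \<longleftrightarrow>
     (\<exists>d. (\<forall>n. L n \<in> grassmannian d) \<and> T \<in> grassmannian d) \<and>
     (\<lambda>n. subspace_dist (L n) T) \<longlonglongrightarrow> 0"

section \<open>Whitney stratifications\<close>

definition whitney_a :: "'a::euclidean_space set \<Rightarrow> 'a set \<Rightarrow> bool" where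
  "whitney_a X Y \<longleftrightarrow>
     (\<forall>y\<in>Y. \<forall>x T. (\<forall>n. x n \<in> X) \<and> x \<longlonglongrightarrow> y \<and>
        grassmann_tendsto (\<lambda>n. tangent_space (x n) X) T
        \<longrightarrow> tangent_space y Y \<subseteq> T)"

definition whitney_b :: "'a::euclidean_space set \<Rightarrow> 'a set \<Rightarrow> bool" where
  "whitney_b X Y \<longleftrightarrow>
     (\<forall>y\<in>Y. \<forall>x z T l. (\<forall>n. x n \<in> X \<and> z n \<in> Y \<and> x n \<noteq> z n) \<and> x \<longlonglongrightarrow> y \<and> z \<longlonglongrightarrow> y \<and>
        grassmann_tendsto (\<lambda>n. tangent_space (x n) X) T \<and>
        grassmann_tendsto (\<lambda>n. span {x n - z n}) l
        \<longrightarrow> l \<subseteq> T)"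

text \<open>Strata need not be connected; the last clause is the frontier condition.\<close>

definition stratification :: "'a::euclidean_space set \<Rightarrow> 'a set set \<Rightarrow> bool" where
  "stratification Z \<S> \<longleftrightarrow>
     partition_on Z \<S> \<and> locally_finite_in (top_of_set Z) \<S> \<and>
     (\<forall>X\<in>\<S>. \<exists>d. smooth_submanifold d X) \<and>
     (\<forall>X\<in>\<S>. \<forall>Y\<in>\<S>. Y \<inter> closure X \<noteq> {} \<longrightarrow> Y \<subseteq> closure X)"

definition whitney_stratification :: "'a::euclidean_space set \<Rightarrow> 'a set set \<Rightarrow> bool" where
  "whitney_stratification Z \<S> \<longleftrightarrow>
     stratification Z \<S> \<and>
     (\<forall>X\<in>\<S>. \<forall>Y\<in>\<S>. X \<noteq> Y \<longrightarrow> whitney_a X Y \<and> whitney_b X Y)"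

section \<open>Map germs at the origin\<close>

text \<open>A map germ is given by a representative: an open neighbourhood \<^term>\<open>U\<close> of the origin and a
  function whose values outside \<^term>\<open>U\<close> are irrelevant.\<close>

definition analytic_germ_rep :: "(real ^ 'm) set \<Rightarrow> (real ^ 'm \<Rightarrow> real ^ 'p) \<Rightarrow> bool" where
  "analytic_germ_rep U G \<longleftrightarrow> open U \<and> 0 \<in> U \<and> real_analytic_on U G \<and> G 0 = 0"

definition nonconstant_germ :: "(real ^ 'm \<Rightarrow> real ^ 'p) \<Rightarrow> bool" where
  "nonconstant_germ G \<longleftrightarrow> \<not> (\<exists>c. \<forall>\<^sub>F x in nhds 0. G x = c)"

definition zero_locus :: "(real ^ 'm) set \<Rightarrow> (real ^ 'm \<Rightarrow> real ^ 'p) \<Rightarrow> (real ^ 'm) set" where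
  "zero_locus U G = {x\<in>U. G x = 0}"

definition Sing :: "(real ^ 'm) set \<Rightarrow> (real ^ 'm \<Rightarrow> real ^ 'p) \<Rightarrow> (real ^ 'm) set" where
  "Sing U G = {x\<in>U. rank (jacobian G (at x)) \<noteq> min CARD('m) CARD('p)}"

definition Disc :: "(real ^ 'm) set \<Rightarrow> (real ^ 'm \<Rightarrow> real ^ 'p) \<Rightarrow> (real ^ 'p) set" where
  "Disc U G = G ` Sing U G"

definition same_set_germ :: "'a::real_normed_vector set \<Rightarrow> 'a set \<Rightarrow> bool" where
  "same_set_germ A B \<longleftrightarrow> (\<forall>\<^sub>F x in nhds 0. x \<in> A \<longleftrightarrow> x \<in> B)"

text \<open>The set germ of \<^term>\<open>Disc U G\<close> can depend on the representative, so the equality of germs with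
  \<^term>\<open>{0}\<close> is required for all sufficiently small representatives.\<close>

definition isolated_critical_value :: "(real ^ 'm) set \<Rightarrow> (real ^ 'm \<Rightarrow> real ^ 'p) \<Rightarrow> bool" where
  "isolated_critical_value U G \<longleftrightarrow>
     (\<forall>\<^sub>F r in at_right 0. same_set_germ (Disc (U \<inter> ball 0 r) G) {0})"

definition thom_condition ::
  "(real ^ 'm \<Rightarrow> real ^ 'p) \<Rightarrow> (real ^ 'm) set \<Rightarrow> (real ^ 'm) set \<Rightarrow> bool" where
  "thom_condition G X W \<longleftrightarrow>
     (\<forall>y\<in>W. \<forall>x T. (\<forall>n. x n \<in> X) \<and> x \<longlonglongrightarrow> y \<and>
        grassmann_tendsto (\<lambda>n. {v. frechet_derivative G (at (x n)) v = 0}) T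
        \<longrightarrow> tangent_space y W \<subseteq> T)"

definition thom_regular :: "(real ^ 'm) set \<Rightarrow> (real ^ 'm \<Rightarrow> real ^ 'p) \<Rightarrow> bool" where
  "thom_regular U G \<longleftrightarrow>
     (\<exists>\<epsilon>>0. ball 0 \<epsilon> \<subseteq> U \<and>
       (\<exists>\<W>. stratification (zero_locus U G \<inter> ball 0 \<epsilon>) \<W> \<and>
         whitney_stratification (ball 0 \<epsilon>) ({ball 0 \<epsilon> - zero_locus U G} \<union> \<W>) \<and>
         (\<forall>W\<in>\<W>. thom_condition G (ball 0 \<epsilon> - zero_locus U G) W)))"

end

theory Submission
  imports Defs
begin

text \<open>Small spheres are transverse to the strata of the zero locus: for a stratum whose closure
  contains the origin, Whitney's condition (b) applied to secants ending at the origin puts the limit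
  of the radial directions into the limit of the tangent spaces, so the tangent spaces are not
  orthogonal to the radius; for the stratum of the origin itself this is a first-order estimate in a
  chart. If the sphere and the fibres were tangent along a sequence tending to a point of the zero
  locus on the sphere, the kernels of the differential would be orthogonal to the radius, and so would
  a limit of them. By Thom's condition this limit contains the tangent space of the stratum,
  a contradiction. Whitney's condition (b) at the origin thus replaces the curve selection lemma.\<close>

section \<open>Maps of class C^k\<close>

text \<open>Off the zero locus the claim reduces to linear algebra: where the differential is onto,
  sphere and fibre are transverse at \<open>y\<close> as soon as some kernel vector is not
  orthogonal to \<open>y\<close>. Since transversality also asks both sets to be smooth submanifolds
  near \<open>y\<close>, this criterion rests on a local submersion theorem with smooth charts, and
  the power series of \<open>G\<close> must first be turned into C^\<infinity> regularity. The
  isolated critical value enters at a point \<open>x\<close> of the zero locus on the sphere: values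
  of \<open>G\<close> near \<open>x\<close> are near 0, so 0 is the only critical value among them
  and nearby points off the zero locus are regular. Their kernels all have dimension m - p, so they
  lie in one compact Grassmannian and a limit exists along a subsequence. The bound on the radius
  serves all strata at once because local finiteness leaves only finitely many of them near the
  origin. With the radius fixed, the neighbourhood in the sphere is assembled point by point, so
  Thom's condition is applied at a single point at a time.\<close>

lemma Ck_on_subset: "Ck_on k S f \<Longrightarrow> T \<subseteq> S \<Longrightarrow> Ck_on k T f"
  by (induction k arbitrary: f) (auto intro: continuous_on_subset)

text \<open>Derivatives are taken in the full space, so equality on \<open>S\<close> passes to them
  only because \<open>S\<close> is open.\<close>

lemma Ck_on_cong:
  assumes "open S" "\<And>x. x \<in> S \<Longrightarrow> f x = g x" "Ck_on k S f"
  shows "Ck_on k S g"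
  using assms(2,3)
proof (induction k arbitrary: f g)
  case 0
  then show ?case by (simp cong: continuous_on_cong)
next
  case (Suc k)
  have d: "g differentiable at x" "frechet_derivative f (at x) = frechet_derivative g (at x)" if "x \<in> S" for x
  proof -
    have f: "(f has_derivative frechet_derivative f (at x)) (at x)"
      using Suc.prems(2) that by (simp add: frechet_derivative_works)
    have "(g has_derivative frechet_derivative f (at x)) (at x)"
      by (rule has_derivative_transform_within_open[OF f assms(1) that]) (use Suc.prems(1) in auto)
    then show "g differentiable at x" "frechet_derivative f (at x) = frechet_derivative g (at x)"
      by (auto simp: differentiable_def frechet_derivative_at)
  qed
  have "Ck_on k S (\<lambda>x. frechet_derivative g (at x) v)" for v
    by (rule Suc.IH[of "\<lambda>x. frechet_derivative f (at x) v"]) (use Suc.prems(2) d in auto)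
  then show ?case using d by simp
qed

text \<open>Lets later inductions work with an explicit formula for the derivative in place of the
  chosen value \<open>frechet_derivative\<close>.\<close>

lemma Ck_on_SucI:
  assumes "open S" "\<And>x. x \<in> S \<Longrightarrow> (f has_derivative f' x) (at x)" "\<And>v. Ck_on k S (\<lambda>x. f' x v)"
  shows "Ck_on (Suc k) S f"
proof -
  have "Ck_on k S (\<lambda>x. frechet_derivative f (at x) v)" for v
    by (rule Ck_on_cong[OF assms(1) _ assms(3)[of v]]) (use assms(2) frechet_derivative_at in fastforce)
  then show ?thesis using assms(2) by (auto simp: differentiable_def)
qed

lemma Ck_on_SucD:
  assumes "Ck_on (Suc k) S f" "x \<in> S"
  shows "(f has_derivative frechet_derivative f (at x)) (at x)"
  using assms by (simp add: frechet_derivative_works)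

lemma Ck_on_Suc_imp: "Ck_on (Suc k) S f \<Longrightarrow> Ck_on k S f"
proof (induction k arbitrary: f)
  case 0
  then show ?case
    by (auto intro!: continuous_at_imp_continuous_on differentiable_imp_continuous_within)
next
  case (Suc k)
  then show ?case by (metis Ck_on.simps(2))
qed

lemma Ck_on_locally:
  assumes "\<And>x. x \<in> S \<Longrightarrow> \<exists>T. open T \<and> x \<in> T \<and> Ck_on k T f"
  shows "Ck_on k S f"
  using assms
proof (induction k arbitrary: f)
  case 0
  show ?case
    unfolding Ck_on.simps
    by (rule continuous_at_imp_continuous_on) (use 0 in \<open>force simp: continuous_on_eq_continuous_at\<close>)
next
  case (Suc k)
  then show ?case by (simp, metis)
qed

section \<open>Closure properties of the class C^k\<close>

lemma Ck_on_const: "open S \<Longrightarrow> Ck_on k S (\<lambda>x. c)"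
  by (induction k arbitrary: c) auto

lemma Ck_on_linear: 
  assumes "open S" "bounded_linear f"
  shows "Ck_on k S f"
proof (cases k)
  case 0
  then show ?thesis using assms by (simp add: linear_continuous_on)
next
  case (Suc n)
  show ?thesis unfolding Suc
    by (rule Ck_on_SucI[OF assms(1), of f "\<lambda>_. f"])
      (auto intro: bounded_linear_imp_has_derivative assms Ck_on_const)
qed

lemma Ck_on_add:
  assumes "open S" "Ck_on k S f" "Ck_on k S g"
  shows "Ck_on k S (\<lambda>x. f x + g x)"
  using assms(2,3)
proof (induction k arbitrary: f g)
  case (Suc k)
  show ?case
    by (rule Ck_on_SucI[OF assms(1), where f' = "\<lambda>x v. frechet_derivative f (at x) v + frechet_derivative g (at x) v"])
      (use Suc in \<open>auto intro!: has_derivative_add Ck_on_SucD[of k S]\<close>)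
qed (auto intro: continuous_intros)

lemma Ck_on_sum:
  assumes "open S" "\<And>i. i \<in> I \<Longrightarrow> Ck_on k S (f i)"
  shows "Ck_on k S (\<lambda>x. \<Sum>i\<in>I. f i x)"
  using assms(2)
  by (induction I rule: infinite_finite_induct) (auto intro: Ck_on_const Ck_on_add assms(1))

text \<open>The product rule gives two terms of the same bilinear shape, so the induction closes.
  The undifferentiated factors enter with one order less than assumed.\<close>

lemma Ck_on_bilinear:
  assumes "open S" "bounded_bilinear b" "Ck_on k S f" "Ck_on k S g"
  shows "Ck_on k S (\<lambda>x. b (f x) (g x))"
  using assms(3,4)
proof (induction k arbitrary: f g)
  case 0
  then show ?case by (auto intro: bounded_bilinear.continuous_on[OF assms(2)])
next
  case (Suc k)
  have f: "Ck_on k S f" and g: "Ck_on k S g" using Suc.prems Ck_on_Suc_imp by blast+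
  show ?case
  proof (rule Ck_on_SucI[OF assms(1), where f' = "\<lambda>x v. b (f x) (frechet_derivative g (at x) v) + b (frechet_derivative f (at x) v) (g x)"])
    fix x assume "x \<in> S"
    show "((\<lambda>x. b (f x) (g x)) has_derivative (\<lambda>v. b (f x) (frechet_derivative g (at x) v) + b (frechet_derivative f (at x) v) (g x))) (at x)"
      by (intro bounded_bilinear.FDERIV[OF assms(2)] Ck_on_SucD[of k S] Suc.prems \<open>x \<in> S\<close>)
  next
    fix v
    show "Ck_on k S (\<lambda>x. b (f x) (frechet_derivative g (at x) v) + b (frechet_derivative f (at x) v) (g x))"
      using Suc.prems by (intro Ck_on_add assms(1) Suc.IH f g) auto
  qed
qed

lemmas Ck_on_scaleR = Ck_on_bilinear[OF _ bounded_bilinear_scaleR]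
lemmas Ck_on_mult = Ck_on_bilinear[OF _ bounded_bilinear_mult]
lemmas Ck_on_inner = Ck_on_bilinear[OF _ bounded_bilinear_inner]

lemma Ck_on_prod:
  fixes f :: "'i \<Rightarrow> 'a::euclidean_space \<Rightarrow> real"
  assumes "open S" "\<And>i. i \<in> I \<Longrightarrow> Ck_on k S (f i)"
  shows "Ck_on k S (\<lambda>x. \<Prod>i\<in>I. f i x)"
  using assms(2)
  by (induction I rule: infinite_finite_induct) (auto intro: Ck_on_const Ck_on_mult assms(1))

lemma Ck_on_inverse:
  fixes f :: "'a::euclidean_space \<Rightarrow> real"
  assumes "open S" "Ck_on k S f" "\<And>x. x \<in> S \<Longrightarrow> f x \<noteq> 0"
  shows "Ck_on k S (\<lambda>x. inverse (f x))"
  using assms(2)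
proof (induction k)
  case 0
  then show ?case using assms(3) by (auto intro: continuous_intros)
next
  case (Suc k)
  have i: "Ck_on k S (\<lambda>x. inverse (f x))" using Suc Ck_on_Suc_imp by blast
  show ?case
  proof (rule Ck_on_SucI[OF assms(1), where f' = "\<lambda>x v. (-1) * ((inverse (f x) * frechet_derivative f (at x) v) * inverse (f x))"])
    fix x assume "x \<in> S"
    then show "((\<lambda>x. inverse (f x)) has_derivative (\<lambda>v. (-1) * ((inverse (f x) * frechet_derivative f (at x) v) * inverse (f x)))) (at x)"
      using Deriv.has_derivative_inverse[OF assms(3) Ck_on_SucD[OF Suc.prems]] by auto
  next
    fix v
    show "Ck_on k S (\<lambda>x. (-1) * ((inverse (f x) * frechet_derivative f (at x) v) * inverse (f x)))"
      using Suc.prems by (intro Ck_on_mult i Ck_on_const assms(1)) auto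
  qed
qed

lemma Ck_on_compose:
  fixes g :: "'a::euclidean_space \<Rightarrow> 'b::euclidean_space" and h :: "'b \<Rightarrow> 'c::euclidean_space"
  assumes "open S" "Ck_on k T h" "Ck_on k S g" "\<And>x. x \<in> S \<Longrightarrow> g x \<in> T"
  shows "Ck_on k S (\<lambda>x. h (g x))"
  using assms(2,3)
proof (induction k arbitrary: h)
  case 0
  then show ?case using assms(4) by (auto intro: continuous_on_compose2)
next
  case (Suc k)
  let ?g = "\<lambda>x v. frechet_derivative g (at x) v" and ?h = "\<lambda>x v. frechet_derivative h (at x) v"
  show ?case
  \<comment> \<open>In the chain rule the vector fed to the derivative of \<open>h\<close> varies
    with \<open>x\<close>, whereas \<open>Ck_on\<close> speaks of fixed directions only. Expanding
    that vector in the basis separates the two dependences.\<close>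
  proof (rule Ck_on_SucI[OF assms(1), where f' = "\<lambda>x v. \<Sum>b\<in>Basis. (?g x v \<bullet> b) *\<^sub>R ?h (g x) b"])
    fix x assume x: "x \<in> S"
    have h: "(h has_derivative ?h (g x)) (at (g x))"
      using Ck_on_SucD[OF Suc.prems(1)] assms(4) x by blast
    have "((\<lambda>x. h (g x)) has_derivative (\<lambda>v. ?h (g x) (?g x v))) (at x)"
      by (rule has_derivative_compose[OF Ck_on_SucD[OF Suc.prems(2) x] h])
    moreover have "?h (g x) (?g x v) = (\<Sum>b\<in>Basis. (?g x v \<bullet> b) *\<^sub>R ?h (g x) b)" for v
    proof -
      have "?h (g x) (?g x v) = ?h (g x) (\<Sum>b\<in>Basis. (?g x v \<bullet> b) *\<^sub>R b)"
        by (simp add: euclidean_representation)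
      then show ?thesis
        using has_derivative_linear[OF h] by (simp add: linear_sum linear_scale)
    qed
    ultimately show "((\<lambda>x. h (g x)) has_derivative (\<lambda>v. \<Sum>b\<in>Basis. (?g x v \<bullet> b) *\<^sub>R ?h (g x) b)) (at x)"
      by simp
  next
    fix v
    show "Ck_on k S (\<lambda>x. \<Sum>b\<in>Basis. (?g x v \<bullet> b) *\<^sub>R ?h (g x) b)"
      using Suc.prems
      by (intro Ck_on_sum Ck_on_scaleR Ck_on_inner Ck_on_const Suc.IH assms(1) Ck_on_Suc_imp[of k S g]) auto
  qed
qed

lemma Ck_on_vec:
  fixes f :: "'a::euclidean_space \<Rightarrow> real ^ 'n"
  assumes "open S" "\<And>i. Ck_on k S (\<lambda>x. f x $ i)"
  shows "Ck_on k S f"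
proof -
  have "Ck_on k S (\<lambda>x. \<Sum>i\<in>UNIV. (f x $ i) *\<^sub>R axis i (1::real))"
    by (intro Ck_on_sum Ck_on_scaleR Ck_on_const assms)
  moreover have "(\<Sum>i\<in>UNIV. (f x $ i) *\<^sub>R axis i (1::real)) = f x" for x
    using basis_expansion[of "f x"] by (simp add: scalar_mult_eq_scaleR)
  ultimately show ?thesis by simp
qed

lemma Ck_on_vec_nth:
  fixes f :: "'a::euclidean_space \<Rightarrow> real ^ 'n"
  assumes "open S" "Ck_on k S f"
  shows "Ck_on k S (\<lambda>x. f x $ i)"
  by (rule Ck_on_compose[OF assms(1) Ck_on_linear[OF open_UNIV bounded_linear_vec_nth] assms(2)]) auto

section \<open>Charts and tangent spaces\<close>

lemma smooth_on_differentiable: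
  "smooth_on S f \<Longrightarrow> x \<in> S \<Longrightarrow> (f has_derivative frechet_derivative f (at x)) (at x)"
  using Ck_on_SucD unfolding smooth_on_def by blast

lemma smooth_on_subset: "smooth_on S f \<Longrightarrow> T \<subseteq> S \<Longrightarrow> smooth_on T f"
  unfolding smooth_on_def using Ck_on_subset by blast

lemma Ck_on_det:
  fixes A :: "'a::euclidean_space \<Rightarrow> real ^ 'n ^ 'n"
  assumes "open S" "\<And>i j. Ck_on k S (\<lambda>x. A x $ i $ j)"
  shows "Ck_on k S (\<lambda>x. det (A x))"
  unfolding det_def by (intro Ck_on_sum Ck_on_mult Ck_on_prod Ck_on_const assms)

text \<open>Bootstraps a differentiable inverse to all orders: its derivative is the inverse of the
  derivative of \<open>f\<close> along \<open>g\<close>, so each order of regularity of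
  \<open>g\<close> yields the next one.\<close>

lemma smooth_on_inverse:
  fixes f g :: "real ^ 'n \<Rightarrow> real ^ 'n"
  assumes "open U" "open V" "smooth_on U f" and gV: "\<And>y. y \<in> V \<Longrightarrow> g y \<in> U"
    and g': "\<And>y. y \<in> V \<Longrightarrow> (g has_derivative g' y) (at y)"
    and inv: "\<And>y v. y \<in> V \<Longrightarrow> frechet_derivative f (at (g y)) (g' y v) = v"
  shows "smooth_on V g"
  unfolding smooth_on_def
proof
  fix k
  show "Ck_on k V g"
  proof (induction k)
    case 0
    then show ?case
      using g' by (auto intro!: continuous_at_imp_continuous_on has_derivative_continuous)
  next
    case (Suc k)
    \<comment> \<open>By Cramer's rule the entries of the inverse Jacobian are rational functions of those of the
      Jacobian of \<open>f\<close> along \<open>g\<close>, hence as regular as \<open>g\<close>.\<close>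
    define A where "A y = matrix (frechet_derivative f (at (g y)))" for y
    have A: "A y *v u = frechet_derivative f (at (g y)) u" if "y \<in> V" for y u
      using smooth_on_differentiable[OF assms(3) gV[OF that]]
      by (metis A_def has_derivative_linear matrix_vector_mul(2))
    have det: "det (A y) \<noteq> 0" if "y \<in> V" for y
      using inv[OF that] A[OF that]
      by (metis full_rank_surjective det_eq_0_rank less_irrefl surjI)
    have Ak: "Ck_on k V (\<lambda>y. A y $ i $ j)" for i j
    proof -
      have "Ck_on k U (\<lambda>x. frechet_derivative f (at x) (axis j 1) $ i)"
        using assms(1,3) by (intro Ck_on_vec_nth) (auto simp: smooth_on_def dest: spec[where x = "Suc k"])
      then show ?thesis
        unfolding A_def matrix_def by (simp, rule Ck_on_compose[OF assms(2) _ Suc.IH gV])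
    qed
    show ?case
    proof (rule Ck_on_SucI[OF assms(2) g'])
      fix v
      \<comment> \<open>\<open>?C y k\<close> is \<open>A y\<close> with column \<open>k\<close>
        replaced by \<open>v\<close>, the numerator matrix in Cramer's rule.\<close>
      let ?C = "\<lambda>y k. (\<chi> i j. if j = k then v $ i else A y $ i $ j)"
      have "Ck_on k V (\<lambda>y. \<chi> i. det (?C y i) * inverse (det (A y)))"
      proof (rule Ck_on_vec[OF assms(2)])
        fix m
        have "Ck_on k V (\<lambda>y. ?C y m $ i $ j)" for i j
          using Ak assms(2) by (cases "j = m") (auto intro: Ck_on_const)
        then show "Ck_on k V (\<lambda>y. (\<chi> i. det (?C y i) * inverse (det (A y))) $ m)"
          unfolding vec_lambda_beta using det Ak assms(2) by (intro Ck_on_mult Ck_on_det Ck_on_inverse) auto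
      qed
      moreover have "(\<chi> i. det (?C y i) * inverse (det (A y))) = g' y v" if "y \<in> V" for y
      proof -
        have "A y *v g' y v = v" using A inv that by simp
        then show ?thesis unfolding cramer[OF det[OF that]] divide_inverse by (rule sym)
      qed
      ultimately show "Ck_on k V (\<lambda>y. g' y v)"
        by (rule Ck_on_cong[OF assms(2), rotated])
    qed
  qed
qed

lemma chart_derivatives_inverse:
  fixes \<phi> :: "'a::euclidean_space \<Rightarrow> 'a"
  assumes "open U" "x \<in> U" "open V" "homeomorphism U V \<phi> \<psi>" "smooth_on U \<phi>" "smooth_on V \<psi>"
  shows "frechet_derivative \<phi> (at x) (frechet_derivative \<psi> (at (\<phi> x)) v) = v"
    and "frechet_derivative \<psi> (at (\<phi> x)) (frechet_derivative \<phi> (at x) v) = v"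
proof -
  have y: "\<phi> x \<in> V" "\<psi> (\<phi> x) = x" using assms(2,4) by (auto simp: homeomorphism_def)
  have f: "(\<phi> has_derivative frechet_derivative \<phi> (at x)) (at x)"
    and g: "(\<psi> has_derivative frechet_derivative \<psi> (at (\<phi> x))) (at (\<phi> x))"
    using smooth_on_differentiable assms(2,5,6) y by blast+
  have "((\<lambda>z. \<phi> (\<psi> z)) has_derivative (\<lambda>v. frechet_derivative \<phi> (at x) (frechet_derivative \<psi> (at (\<phi> x)) v))) (at (\<phi> x))"
    using has_derivative_compose[OF g, of \<phi>] f y by simp
  moreover have "((\<lambda>z. \<phi> (\<psi> z)) has_derivative (\<lambda>v. v)) (at (\<phi> x))"
    by (rule has_derivative_transform_within_open[OF has_derivative_ident assms(3) y(1)])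
      (use assms(4) in \<open>auto simp: homeomorphism_def\<close>)
  ultimately show "frechet_derivative \<phi> (at x) (frechet_derivative \<psi> (at (\<phi> x)) v) = v"
    using has_derivative_unique by metis
  have "((\<lambda>z. \<psi> (\<phi> z)) has_derivative (\<lambda>v. frechet_derivative \<psi> (at (\<phi> x)) (frechet_derivative \<phi> (at x) v))) (at x)"
    using has_derivative_compose[OF f g] .
  moreover have "((\<lambda>z. \<psi> (\<phi> z)) has_derivative (\<lambda>v. v)) (at x)"
    by (rule has_derivative_transform_within_open[OF has_derivative_ident assms(1,2)])
      (use assms(4) in \<open>auto simp: homeomorphism_def\<close>)
  ultimately show "frechet_derivative \<psi> (at (\<phi> x)) (frechet_derivative \<phi> (at x) v) = v"
    using has_derivative_unique by metis
qed

text \<open>A curve in \<open>M\<close> through \<open>x\<close> is carried by \<open>\<phi>\<close>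
  into \<open>L\<close> near \<open>t = 0\<close>, so its difference quotients lie in
  \<open>L\<close>; a subspace is closed, hence contains their limit. Conversely,
  \<open>\<psi>\<close> carries the line through \<open>\<phi> x\<close> in direction
  \<open>w\<close> to a curve in \<open>M\<close> with the prescribed velocity.\<close>

lemma tangent_space_chart:
  fixes \<phi> :: "'a::euclidean_space \<Rightarrow> 'a"
  assumes chart: "open U" "x \<in> U" "open V" "homeomorphism U V \<phi> \<psi>" "smooth_on U \<phi>" "smooth_on V \<psi>"
    and "x \<in> M" "subspace L" and M: "\<phi> ` (U \<inter> M) = V \<inter> L"
  shows "tangent_space x M = frechet_derivative \<psi> (at (\<phi> x)) ` L"
proof -
  let ?D = "frechet_derivative \<phi> (at x)" and ?E = "frechet_derivative \<psi> (at (\<phi> x))"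
  have y: "\<phi> x \<in> V" "\<phi> x \<in> L" "\<psi> (\<phi> x) = x"
    using assms by (auto simp: homeomorphism_def)
  have \<phi>: "(\<phi> has_derivative ?D) (at x)" and \<psi>: "(\<psi> has_derivative ?E) (at (\<phi> x))"
    using smooth_on_differentiable chart y by blast+
  have "v \<in> ?E ` L" if "v \<in> tangent_space x M" for v
  proof -
    obtain e \<gamma> where e: "e > 0" and \<gamma>: "\<gamma> ` {-e<..<e} \<subseteq> M" "\<gamma> (0::real) = x"
      "(\<gamma> has_vector_derivative v) (at 0)"
      using \<open>v \<in> tangent_space x M\<close> by (auto simp: tangent_space_def)
    have "((\<lambda>t. \<phi> (\<gamma> t)) has_derivative (\<lambda>t. ?D (t *\<^sub>R v))) (at 0)"
      using has_derivative_compose[OF \<gamma>(3)[unfolded has_vector_derivative_def], of \<phi> ?D] \<phi> \<gamma>(2) by simp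
    then have "((\<lambda>t. \<phi> (\<gamma> t)) has_vector_derivative ?D v) (at 0)"
      using has_derivative_linear[OF \<phi>] by (simp add: has_vector_derivative_def linear_scale)
    moreover have "(\<phi> (\<gamma> t) - \<phi> x) /\<^sub>R t - ?D v = (\<phi> (\<gamma> t) - \<phi> x - t *\<^sub>R ?D v) /\<^sub>R t" if "t \<noteq> 0" for t
      using that by (simp add: scaleR_diff_right)
    ultimately have "((\<lambda>t. norm ((\<phi> (\<gamma> t) - \<phi> x) /\<^sub>R t - ?D v)) \<longlongrightarrow> 0) (at 0)"
      using \<gamma>(2) unfolding has_vector_derivative_def has_derivative_at
      by (elim conjE Lim_transform_eventually)
        (auto simp: eventually_at_filter divide_inverse mult.commute)
    then have lim: "((\<lambda>t. (\<phi> (\<gamma> t) - \<phi> x) /\<^sub>R t) \<longlongrightarrow> ?D v) (at 0)"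
      by (simp add: tendsto_norm_zero_iff LIM_zero_iff)
    have "isCont \<gamma> 0" using \<gamma>(3) has_vector_derivative_continuous by blast
    then have "\<forall>\<^sub>F t in at 0. \<gamma> t \<in> U"
      using chart(1,2) \<gamma>(2) by (metis isCont_def topological_tendstoD)
    moreover have "\<forall>\<^sub>F t in at 0. t \<in> {-e<..<e}"
      using e by (intro eventually_at_in_open') auto
    ultimately have "\<forall>\<^sub>F t in at 0. (\<phi> (\<gamma> t) - \<phi> x) /\<^sub>R t \<in> L"
    proof eventually_elim
      case (elim t)
      then have "\<phi> (\<gamma> t) \<in> L" using \<gamma>(1) M by blast
      then show ?case using y assms(8) by (simp add: subspace_diff subspace_scale)
    qed
    then have "?D v \<in> L"
      using Lim_in_closed_set[OF closed_subspace[OF assms(8)] _ _ lim] by simp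
    then show ?thesis
      using chart_derivatives_inverse(2)[OF chart, of v] by (metis imageI)
  qed
  moreover have "?E w \<in> tangent_space x M" if "w \<in> L" for w
  proof -
    let ?\<gamma> = "\<lambda>t. \<psi> (\<phi> x + t *\<^sub>R w)"
    have "open ((\<lambda>t. \<phi> x + t *\<^sub>R w) -` V)"
      by (intro open_vimage chart(3) continuous_intros)
    moreover have "0 \<in> (\<lambda>t. \<phi> x + t *\<^sub>R w) -` V" using y(1) by simp
    ultimately obtain e where e: "e > 0" "ball 0 e \<subseteq> (\<lambda>t. \<phi> x + t *\<^sub>R w) -` V"
      by (rule openE)
    have eV: "\<phi> x + t *\<^sub>R w \<in> V" if "\<bar>t\<bar> < e" for t
      using subsetD[OF e(2), of t] that by simp
    have "smooth_on {-e<..<e} ?\<gamma>"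
      unfolding smooth_on_def
    proof
      fix k
      have "Ck_on k {-e<..<e} (\<lambda>t. \<phi> x + t *\<^sub>R w)"
        by (intro Ck_on_add Ck_on_const Ck_on_scaleR Ck_on_linear) auto
      then show "Ck_on k {-e<..<e} ?\<gamma>"
        by (rule Ck_on_compose[OF open_greaterThanLessThan spec[OF chart(6)[unfolded smooth_on_def]]])
          (simp add: eV abs_less_iff)
    qed
    moreover have "?\<gamma> t \<in> M" if "t \<in> {-e<..<e}" for t
    proof -
      have "\<phi> x + t *\<^sub>R w \<in> V \<inter> L"
        using eV[of t] that y \<open>w \<in> L\<close> assms(8) by (auto simp: subspace_add subspace_scale)
      then obtain z where "z \<in> U \<inter> M" "\<phi> x + t *\<^sub>R w = \<phi> z" using M by blast
      then show ?thesis using chart(4) by (auto simp: homeomorphism_def)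
    qed
    moreover have "(?\<gamma> has_vector_derivative ?E w) (at 0)"
    proof -
      have "((\<lambda>t. \<phi> x + t *\<^sub>R w) has_derivative (\<lambda>t. t *\<^sub>R w)) (at 0)"
        by (auto intro!: derivative_eq_intros)
      from has_derivative_compose[OF this, of \<psi> ?E] show ?thesis
        using \<psi> has_derivative_linear[OF \<psi>] by (simp add: has_vector_derivative_def linear_scale)
    qed
    ultimately show ?thesis
      unfolding tangent_space_def using e(1) y(3) by (auto intro!: exI[of _ e] exI[of _ ?\<gamma>])
  qed
  ultimately show ?thesis by blast
qed

lemma smooth_submanifoldE:
  fixes M :: "'a::euclidean_space set"
  assumes "smooth_submanifold d M" "x \<in> M"
  obtains U V \<phi> \<psi> and L :: "'a set" where
    "open U" "x \<in> U" "open V" "homeomorphism U V \<phi> \<psi>" "smooth_on U \<phi>" "smooth_on V \<psi>"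
    "subspace L" "dim L = d" "\<phi> ` (U \<inter> M) = V \<inter> L"
  using bspec[OF assms(1)[unfolded smooth_submanifold_def] assms(2)] by (elim exE conjE) rule

text \<open>Puts all tangent spaces of one stratum into the same Grassmannian, so that limits of
  them can be extracted.\<close>

lemma tangent_space_submanifold:
  assumes "smooth_submanifold d M" "x \<in> M"
  shows "subspace (tangent_space x M)" "dim (tangent_space x M) = d"
proof -
  obtain U V \<phi> \<psi> and L :: "'a set" where
    c: "open U" "x \<in> U" "open V" "homeomorphism U V \<phi> \<psi>" "smooth_on U \<phi>" "smooth_on V \<psi>"
    and L: "subspace L" "dim L = d" "\<phi> ` (U \<inter> M) = V \<inter> L"
    using smooth_submanifoldE[OF assms] .
  let ?E = "frechet_derivative \<psi> (at (\<phi> x))"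
  have eq: "tangent_space x M = ?E ` L"
    by (rule tangent_space_chart[OF c assms(2) L(1,3)])
  have "\<phi> x \<in> V" using c by (auto simp: homeomorphism_def)
  then have lin: "linear ?E" using smooth_on_differentiable[OF c(6)] has_derivative_linear by blast
  have inj: "inj ?E" using chart_derivatives_inverse(1)[OF c] by (metis injI)
  show "subspace (tangent_space x M)" unfolding eq using lin L(1) by (rule linear_subspace_image)
  show "dim (tangent_space x M) = d"
    unfolding eq using dim_image_eq[OF lin inj_on_subset[OF inj subset_UNIV]] L(2) by simp
qed

text \<open>Charts restrict to open subsets. \<open>transverse_at\<close> asks for one neighbourhood
  that works for both sets, while each is first obtained with a neighbourhood of its own.\<close>

lemma smooth_submanifold_open_subset:
  assumes "smooth_submanifold d M" "open W"
  shows "smooth_submanifold d (W \<inter> M)"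
  unfolding smooth_submanifold_def
proof
  fix x assume x: "x \<in> W \<inter> M"
  obtain U V \<phi> \<psi> and L :: "'a set" where
    c: "open U" "x \<in> U" "open V" "homeomorphism U V \<phi> \<psi>" "smooth_on U \<phi>" "smooth_on V \<psi>"
    and L: "subspace L" "dim L = d" "\<phi> ` (U \<inter> M) = V \<inter> L"
    using smooth_submanifoldE[OF assms(1)] x by blast
  let ?V = "V \<inter> \<psi> -` W"
  have "open ?V"
    by (rule continuous_open_preimage[OF homeomorphism_cont2[OF c(4)] c(3) assms(2)])
  moreover have V: "V = \<phi> ` U" and \<psi>: "\<And>u. u \<in> U \<Longrightarrow> \<psi> (\<phi> u) = u"
    using c(4) by (simp_all add: homeomorphism_def)
  have im: "\<phi> ` (U \<inter> W) = ?V"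
    unfolding V using \<psi> by auto
  moreover have "\<phi> ` ((U \<inter> W) \<inter> (W \<inter> M)) = ?V \<inter> L"
  proof -
    have "\<phi> ` ((U \<inter> W) \<inter> (W \<inter> M)) = \<phi> ` (U \<inter> W) \<inter> \<phi> ` (U \<inter> M)"
      using \<psi> by (auto simp: image_iff) (metis IntI)
    then show ?thesis unfolding im L(3) by blast
  qed
  moreover have "homeomorphism (U \<inter> W) ?V \<phi> \<psi>"
    by (rule homeomorphism_of_subsets[OF c(4)]) (use im in auto)
  moreover have "smooth_on (U \<inter> W) \<phi>" "smooth_on ?V \<psi>"
    using c smooth_on_subset by blast+
  moreover have "open (U \<inter> W)" "x \<in> U \<inter> W" using c(1,2) x assms(2) by auto
  ultimately show "\<exists>U V \<phi> \<psi> L. open U \<and> x \<in> U \<and> open V \<and> homeomorphism U V \<phi> \<psi> \<and> smooth_on U \<phi> \<and> smooth_on V \<psi> \<and>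
        subspace (L :: 'a set) \<and> dim L = d \<and> \<phi> ` (U \<inter> (W \<inter> M)) = V \<inter> L"
    using L(1,2) by (intro exI conjI)
qed

text \<open>Local form of a submersion. For the tangent space only the inclusion of the kernel is
  recorded: transversality needs enough tangent vectors, not a bound on them.\<close>

lemma submersion_fibre:
  fixes f :: "real ^ 'n \<Rightarrow> 'b::euclidean_space"
  assumes S: "open S" "x0 \<in> S" and f: "smooth_on S f" and surj: "surj (frechet_derivative f (at x0))"
  defines "M \<equiv> {y \<in> S. f y = f x0}"
  obtains W d where "open W" "x0 \<in> W" "smooth_submanifold d (W \<inter> M)"
    "{v. frechet_derivative f (at x0) v = 0} \<subseteq> tangent_space x0 M"
proof -
  let ?D = "\<lambda>x. frechet_derivative f (at x)" and ?l = "frechet_derivative f (at x0)"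
  have D: "(f has_derivative ?D x) (at x)" if "x \<in> S" for x
    using smooth_on_differentiable[OF f that] .
  have l: "linear ?l" using has_derivative_linear[OF D[OF S(2)]] .
  obtain A where A: "linear A" "\<And>w. ?l (A w) = w"
    using linear_surjective_right_inverse[OF l surj] by (metis comp_apply id_apply)
  have bl: "bounded_linear ?l" "bounded_linear A"
    using l A(1) by (simp_all add: linear_conv_bounded_linear)
  \<comment> \<open>A perturbation of the identity with \<open>?l (\<Phi> y) = f y - f x0\<close>, so that it straightens the
    fibre to the kernel of \<open>?l\<close>.\<close>
  define \<Phi> where "\<Phi> = (\<lambda>y. y + A (f y - ?l y - f x0))"
  define \<Phi>' where "\<Phi>' = (\<lambda>x v. v + A (?D x v - ?l v))"
  define F where "F = (\<lambda>x. Blinfun (\<Phi>' x))"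
  have \<Phi>': "(\<Phi> has_derivative \<Phi>' x) (at x)" if "x \<in> S" for x
    unfolding \<Phi>_def \<Phi>'_def
    using bounded_linear.has_derivative[OF bl(2) has_derivative_diff[OF has_derivative_diff[OF D[OF that]
          bounded_linear_imp_has_derivative[OF bl(1)]] has_derivative_const[of "f x0"]]]
    by (auto intro: has_derivative_add has_derivative_ident)
  have F: "blinfun_apply (F x) = \<Phi>' x" if "x \<in> S" for x
    unfolding F_def by (rule bounded_linear_Blinfun_apply[OF has_derivative_bounded_linear[OF \<Phi>'[OF that]]])
  \<comment> \<open>In finite dimension, continuity in the operator norm can be tested on basis
    vectors, which is the form in which C^1 regularity is available.\<close>
  have Fcont: "continuous_on S F"
  proof (rule continuous_on_blinfun_componentwise)
    fix i :: "real ^ 'n"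
    have "Ck_on 1 S f" using f by (auto simp: smooth_on_def)
    then have "continuous_on S (\<lambda>x. ?D x i)" by simp
    then have "continuous_on S (\<lambda>x. \<Phi>' x i)"
      unfolding \<Phi>'_def by (intro continuous_intros bounded_linear.continuous_on[OF bl(2)])
    then show "continuous_on S (\<lambda>x. F x i)" by (simp add: F cong: continuous_on_cong)
  qed
  \<comment> \<open>At \<open>x0\<close> the two derivatives in the correction term cancel, so the
    identity serves as the inverse that the inverse function theorem asks for.\<close>
  have D0: "\<Phi>' x0 v = v" for v using linear_0[OF A(1)] by (simp add: \<Phi>'_def)
  have "id_blinfun o\<^sub>L F x0 = id_blinfun"
    by (rule blinfun_eqI) (simp add: F S(2) D0)
  from inverse_function_theorem[OF S(1), of \<Phi> F, OF _ Fcont S(2) this] \<Phi>'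
  obtain U V g g' where U: "open U" "U \<subseteq> S" "x0 \<in> U" and V: "open V" and hom: "homeomorphism U V \<Phi> g"
    and g': "\<And>y. y \<in> V \<Longrightarrow> (g has_derivative (g' y)) (at y)"
    "\<And>y. y \<in> V \<Longrightarrow> g' y = inv (blinfun_apply (F (g y)))"
    "\<And>y. y \<in> V \<Longrightarrow> bij (blinfun_apply (F (g y)))"
    using F by metis
  have \<Phi>k: "smooth_on U \<Phi>"
    unfolding smooth_on_def
  proof
    fix k
    have "Ck_on k U f" using smooth_on_subset[OF f U(2)] by (simp add: smooth_on_def)
    then have "Ck_on k U (\<lambda>y. f y + (- 1) *\<^sub>R ?l y + - f x0)"
      by (intro Ck_on_add Ck_on_scaleR Ck_on_const Ck_on_linear[OF _ bl(1)] U(1))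
    from Ck_on_compose[OF U(1) Ck_on_linear[OF open_UNIV bl(2)] this]
    show "Ck_on k U \<Phi>"
      unfolding \<Phi>_def by (intro Ck_on_add U(1) Ck_on_linear[OF _ bounded_linear_ident]) simp
  qed
  have gU: "g y \<in> U" if "y \<in> V" for y using hom that by (auto simp: homeomorphism_def)
  have gk: "smooth_on V g"
  proof (rule smooth_on_inverse[OF U(1) V \<Phi>k gU g'(1)])
    fix y v assume y: "y \<in> V"
    then have "g y \<in> S" using gU U(2) by blast
    then have "frechet_derivative \<Phi> (at (g y)) = blinfun_apply (F (g y))"
      using frechet_derivative_at[OF \<Phi>'] F by simp
    then show "frechet_derivative \<Phi> (at (g y)) (g' y v) = v"
      using g'(2,3)[OF y] by (simp add: bij_is_surj surj_f_inv_f)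
  qed
  define K where "K = {v. ?l v = 0}"
  have K: "subspace K" unfolding K_def by (simp add: subspace_def linear_0[OF l] linear_add[OF l] linear_scale[OF l])
  have "?l (\<Phi> y) = f y - f x0" for y
    unfolding \<Phi>_def by (simp add: linear_add[OF l] A(2))
  then have "y \<in> M \<longleftrightarrow> \<Phi> y \<in> K" if "y \<in> U" for y using that U(2) by (auto simp: M_def K_def)
  then have im: "\<Phi> ` (U \<inter> M) = V \<inter> K"
    using hom by (auto simp: homeomorphism_def)
  then have "smooth_submanifold (dim K) (U \<inter> M)"
    unfolding smooth_submanifold_def
    by (intro ballI exI[of _ U] exI[of _ V] exI[of _ \<Phi>] exI[of _ g] exI[of _ K])
      (use U(1) V hom \<Phi>k gk K in auto)
  moreover have "K \<subseteq> tangent_space x0 M"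
  proof -
    have "frechet_derivative \<Phi> (at x0) v = v" for v
      using frechet_derivative_at[OF \<Phi>'[OF S(2)]] D0 by metis
    then have "frechet_derivative g (at (\<Phi> x0)) v = v" for v
      using chart_derivatives_inverse(2)[OF U(1,3) V hom \<Phi>k gk, of v] by simp
    moreover have "x0 \<in> M" using S(2) by (simp add: M_def)
    ultimately show ?thesis
      using tangent_space_chart[OF U(1,3) V hom \<Phi>k gk _ K im] by simp
  qed
  ultimately show thesis using that[OF U(1,3)] unfolding K_def by blast
qed

section \<open>Real analytic maps\<close>

text \<open>Balls of the maximum norm fit multivariate series: on \<open>cube a s\<close> a monomial
  of total degree k, centred at \<open>a\<close>, is bounded by \<open>s ^ k\<close>.\<close>

definition cube :: "real ^ 'm \<Rightarrow> real \<Rightarrow> (real ^ 'm) set" where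
  "cube a s = box (a - vec s) (a + vec s)"

lemma mem_cube: "x \<in> cube a s \<longleftrightarrow> (\<forall>i. \<bar>x $ i - a $ i\<bar> < s)"
  by (auto simp: cube_def mem_box_cart abs_less_iff algebra_simps)

lemma open_cube: "open (cube a s)" and convex_cube: "convex (cube a s)"
  by (simp_all add: cube_def open_box convex_box)

text \<open>The exponents \<open>b n\<close> need not be distinct, so that differentiating a series termwise
  requires no reindexing.\<close>

definition power_series_on :: "real ^ 'm \<Rightarrow> real \<Rightarrow> (real ^ 'm \<Rightarrow> 'b::euclidean_space) \<Rightarrow> bool" where
  "power_series_on a \<rho> f \<longleftrightarrow>
     (\<exists>(b :: nat \<Rightarrow> 'm \<Rightarrow> nat) c.
        (\<forall>s. 0 < s \<and> s < \<rho> \<longrightarrow> summable (\<lambda>n. s ^ (\<Sum>i\<in>UNIV. b n i) * norm (c n))) \<and>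
        (\<forall>x\<in>cube a \<rho>. (\<lambda>n. (\<Prod>i\<in>UNIV. (x $ i - a $ i) ^ b n i) *\<^sub>R c n) sums f x))"

lemma abs_monomial_le:
  fixes y :: "'i \<Rightarrow> real"
  assumes "\<And>i. i \<in> I \<Longrightarrow> \<bar>y i\<bar> \<le> s"
  shows "\<bar>\<Prod>i\<in>I. y i ^ b i\<bar> \<le> s ^ (\<Sum>i\<in>I. b i)"
proof -
  have "\<bar>\<Prod>i\<in>I. y i ^ b i\<bar> = (\<Prod>i\<in>I. \<bar>y i\<bar> ^ b i)" by (simp add: abs_prod power_abs)
  also have "\<dots> \<le> (\<Prod>i\<in>I. s ^ b i)" by (intro prod_mono conjI power_mono assms) auto
  finally show ?thesis by (simp add: power_sum)
qed

text \<open>The factor \<open>k\<close> produced by differentiation is absorbed by a slightly larger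
  radius, since \<open>k * (s / t) ^ k\<close> tends to 0 and is therefore bounded.\<close>

lemma mult_power_pred_le:
  fixes s t :: real
  assumes "0 < s" "s < t"
  obtains C where "\<And>k. real k * s ^ (k - 1) \<le> C * t ^ k"
proof -
  have "(\<lambda>k. real k * (s / t) ^ k) \<longlonglongrightarrow> 0"
    using powser_times_n_limit_0[of "s / t"] assms by simp
  then obtain K where K: "\<And>k. norm (real k * (s / t) ^ k) \<le> K"
    using convergent_imp_Bseq convergentI BseqE by metis
  show thesis
  proof (rule that[of "K / s"])
    fix k
    show "real k * s ^ (k - 1) \<le> K / s * t ^ k"
    proof (cases k)
      case 0
      have "0 \<le> K" using K[of 0] by simp
      then show ?thesis using 0 assms by simp
    next
      case (Suc n)
      have "real k * (s / t) ^ k \<le> K" using K[of k] by simp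
      then have "real k * s ^ k \<le> K * t ^ k"
        using assms by (simp add: power_divide field_simps)
      then show ?thesis using assms Suc by (simp add: field_simps)
    qed
  qed
qed

text \<open>The partial derivative in direction \<open>j\<close> lowers the total degree by one and
  multiplies by at most that degree, so its majorant at \<open>s\<close> is dominated by the
  original one at some \<open>t\<close> between \<open>s\<close> and \<open>\<rho>\<close>.\<close>

lemma summable_derived_series:
  fixes b :: "nat \<Rightarrow> 'm::finite \<Rightarrow> nat" and c :: "nat \<Rightarrow> 'b::euclidean_space"
  assumes sm: "\<And>s. 0 < s \<Longrightarrow> s < \<rho> \<Longrightarrow> summable (\<lambda>n. s ^ (\<Sum>i\<in>UNIV. b n i) * norm (c n))"
    and s: "0 < s" "s < \<rho>"
  shows "summable (\<lambda>n. s ^ (\<Sum>i\<in>UNIV. ((b n)(j := b n j - 1)) i) * norm (real (b n j) *\<^sub>R c n))"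
proof -
  obtain t where t: "s < t" "t < \<rho>" using s dense by blast
  obtain C where C: "\<And>k. real k * s ^ (k - 1) \<le> C * t ^ k"
    using mult_power_pred_le[OF s(1) t(1)] by blast
  have "real (b n j) * s ^ (\<Sum>i\<in>UNIV. ((b n)(j := b n j - 1)) i) \<le> C * t ^ (\<Sum>i\<in>UNIV. b n i)" for n
  \<comment> \<open>For \<open>b n j = 0\<close> truncated subtraction leaves the exponent
    unchanged, but the coefficient vanishes and only nonnegativity of the right-hand side remains to
    be shown.\<close>
  proof (cases "b n j")
    case 0
    have "0 \<le> real (\<Sum>i\<in>UNIV. b n i) * s ^ ((\<Sum>i\<in>UNIV. b n i) - 1)"
      using s by (intro mult_nonneg_nonneg of_nat_0_le_iff) simp
    then have "0 \<le> C * t ^ (\<Sum>i\<in>UNIV. b n i)" using C order_trans by blast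
    then show ?thesis using 0 by simp
  next
    case (Suc k)
    have b: "(\<Sum>i\<in>UNIV. b n i) = b n j + (\<Sum>i\<in>UNIV - {j}. b n i)"
      by (rule sum.remove) auto
    have "(\<Sum>i\<in>UNIV. ((b n)(j := b n j - 1)) i) = k + (\<Sum>i\<in>UNIV - {j}. b n i)"
      using sum.remove[of UNIV j "(b n)(j := b n j - 1)"] Suc by simp
    also have "\<dots> = (\<Sum>i\<in>UNIV. b n i) - 1" using b Suc by simp
    finally have e: "(\<Sum>i\<in>UNIV. ((b n)(j := b n j - 1)) i) = (\<Sum>i\<in>UNIV. b n i) - 1" .
    have "real (b n j) * s ^ ((\<Sum>i\<in>UNIV. b n i) - 1) \<le> real (\<Sum>i\<in>UNIV. b n i) * s ^ ((\<Sum>i\<in>UNIV. b n i) - 1)"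
    proof (rule mult_right_mono)
      have "b n j \<le> (\<Sum>i\<in>UNIV. b n i)" using b by simp
      then show "real (b n j) \<le> real (\<Sum>i\<in>UNIV. b n i)" by (rule of_nat_mono)
    qed (use s in simp)
    then show ?thesis unfolding e using C order_trans by blast
  qed
  from mult_right_mono[OF this norm_ge_zero]
  have le: "norm (s ^ (\<Sum>i\<in>UNIV. ((b n)(j := b n j - 1)) i) * norm (real (b n j) *\<^sub>R c n))
      \<le> C * (t ^ (\<Sum>i\<in>UNIV. b n i) * norm (c n))" for n
    using s by (simp add: abs_mult mult_ac)
  have "summable (\<lambda>n. C * (t ^ (\<Sum>i\<in>UNIV. b n i) * norm (c n)))"
    using sm[of t] s t by (intro summable_mult) auto
  then show ?thesis using le by (rule summable_comparison_test'[where N = 0])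
qed

text \<open>Termwise differentiation, with uniform convergence of the derived series on a smaller
  cube around \<open>a\<close> that still contains \<open>x\<close>. The partial derivatives are
  series on the same cube \<open>cube a \<rho>\<close>, so the argument can be iterated without
  shrinking the domain.\<close>

lemma power_series_on_has_derivative:
  fixes f :: "real ^ 'm \<Rightarrow> 'b::euclidean_space"
  assumes "power_series_on a \<rho> f"
  shows "\<exists>g. (\<forall>j. power_series_on a \<rho> (g j)) \<and>
    (\<forall>x\<in>cube a \<rho>. (f has_derivative (\<lambda>h. \<Sum>j\<in>UNIV. h $ j *\<^sub>R g j x)) (at x))"
proof -
  from assms obtain b c where
    sm0: "\<forall>s. 0 < s \<and> s < \<rho> \<longrightarrow> summable (\<lambda>n. s ^ (\<Sum>i\<in>UNIV. b n i) * norm (c n))" and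
    f0: "\<forall>x\<in>cube a \<rho>. (\<lambda>n. (\<Prod>i\<in>UNIV. (x $ i - a $ i) ^ b n i) *\<^sub>R c n) sums f x"
    unfolding power_series_on_def by (elim exE conjE)
  have sm: "summable (\<lambda>n. s ^ (\<Sum>i\<in>UNIV. b n i) * norm (c n))" if "0 < s" "s < \<rho>" for s
    using sm0 that by simp
  have f: "(\<lambda>n. (\<Prod>i\<in>UNIV. (x $ i - a $ i) ^ b n i) *\<^sub>R c n) sums f x" if "x \<in> cube a \<rho>" for x
    using f0 that by (rule bspec)
  define b' where "b' = (\<lambda>j n. (b n)(j := b n j - 1))"
  define c' where "c' = (\<lambda>j n. real (b n j) *\<^sub>R c n)"
  define T where "T = (\<lambda>j n x. (\<Prod>i\<in>UNIV. (x $ i - a $ i) ^ b' j n i) *\<^sub>R c' j n)"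
  define g where "g = (\<lambda>j x. \<Sum>n. T j n x)"
  have sm': "summable (\<lambda>n. s ^ (\<Sum>i\<in>UNIV. b' j n i) * norm (c' j n))" if "0 < s" "s < \<rho>" for s j
    unfolding b'_def c'_def by (rule summable_derived_series[OF sm that])
  have Tle: "norm (T j n x) \<le> s ^ (\<Sum>i\<in>UNIV. b' j n i) * norm (c' j n)" if "x \<in> cube a s" for s j n x
    unfolding T_def norm_scaleR real_norm_def
    by (intro mult_right_mono abs_monomial_le) (use that in \<open>auto simp: mem_cube less_imp_le\<close>)
  \<comment> \<open>There are finitely many coordinates, so the largest deviation from
    \<open>a\<close> is still below \<open>\<rho>\<close> and leaves room for
    \<open>s\<close>.\<close>
  have ex: "\<exists>s. 0 < s \<and> s < \<rho> \<and> x \<in> cube a s" if "x \<in> cube a \<rho>" for x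
  proof -
    let ?m = "Max (range (\<lambda>i. \<bar>x $ i - a $ i\<bar>))"
    have "?m < \<rho>" using that by (subst Max_less_iff) (auto simp: mem_cube)
    then obtain s where s: "?m < s" "s < \<rho>" using dense by blast
    have "\<bar>x $ i - a $ i\<bar> < s" for i
      using s(1) by (subst (asm) Max_less_iff) auto
    then show ?thesis using s(2) by (metis abs_ge_zero le_less_trans mem_cube)
  qed
  have Tsums: "(\<lambda>n. T j n x) sums g j x" if x: "x \<in> cube a \<rho>" for j x
  proof -
    obtain s where s: "0 < s" "s < \<rho>" "x \<in> cube a s" using ex[OF x] by blast
    show ?thesis
      unfolding g_def
      by (rule summable_sums[OF summable_comparison_test'[OF sm'[OF s(1,2)] Tle[OF s(3)]]])
  qed
  have "power_series_on a \<rho> (g j)" for j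
    unfolding power_series_on_def
    by (intro exI[of _ "b' j"] exI[of _ "c' j"]) (use sm' Tsums in \<open>auto simp: T_def\<close>)
  moreover have "(f has_derivative (\<lambda>h. \<Sum>j\<in>UNIV. h $ j *\<^sub>R g j x)) (at x)" if x: "x \<in> cube a \<rho>" for x
  proof -
    obtain s where s: "0 < s" "s < \<rho>" "x \<in> cube a s" using ex[OF x] by blast
    have sub: "cube a s \<subseteq> cube a \<rho>" unfolding subset_iff mem_cube using s(2) less_trans by blast
    have 1: "((\<lambda>x. (\<Prod>i\<in>UNIV. (x $ i - a $ i) ^ b n i) *\<^sub>R c n) has_derivative
        (\<lambda>h. \<Sum>j\<in>UNIV. h $ j *\<^sub>R T j n x)) (at x within cube a s)" for n x
    proof -
      have nth: "((\<lambda>x. x $ i) has_derivative (\<lambda>h. h $ i)) (at x within cube a s)" for i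
        by (rule bounded_linear_imp_has_derivative[OF bounded_linear_vec_nth])
      have p: "((\<lambda>x. (x $ i - a $ i) ^ b n i) has_derivative
          (\<lambda>h. h $ i * (real (b n i) * (x $ i - a $ i) ^ (b n i - 1)))) (at x within cube a s)" for i
        using has_derivative_power[OF has_derivative_diff[OF nth[of i] has_derivative_const[of "a $ i"]], of "b n i"]
        by (simp add: mult_ac)
      have "((\<lambda>x. (\<Prod>i\<in>UNIV. (x $ i - a $ i) ^ b n i) *\<^sub>R c n) has_derivative
        (\<lambda>h. (\<Sum>j\<in>UNIV. h $ j * (real (b n j) * (x $ j - a $ j) ^ (b n j - 1)) * (\<Prod>i\<in>UNIV - {j}. (x $ i - a $ i) ^ b n i)) *\<^sub>R c n))
         (at x within cube a s)"
        by (intro has_derivative_scaleR_left has_derivative_prod p)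
      moreover have "T j n x = (real (b n j) * (x $ j - a $ j) ^ (b n j - 1) * (\<Prod>i\<in>UNIV - {j}. (x $ i - a $ i) ^ b n i)) *\<^sub>R c n" for j
        using prod.remove[of UNIV j "\<lambda>i. (x $ i - a $ i) ^ b' j n i"]
        by (simp add: T_def b'_def c'_def mult_ac)
      ultimately show ?thesis by (simp add: scaleR_sum_left mult_ac)
    qed
    have 2: "\<forall>\<^sub>F n in sequentially. \<forall>x\<in>cube a s. \<forall>h.
        norm ((\<Sum>k<n. \<Sum>j\<in>UNIV. h $ j *\<^sub>R T j k x) - (\<Sum>j\<in>UNIV. h $ j *\<^sub>R g j x)) \<le> e * norm h" if "e > 0" for e
    proof -
      \<comment> \<open>The error is a sum over the coordinates, each contributing at most
        \<open>norm h * ?e\<close>.\<close>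
      let ?e = "e / real CARD('m)"
      have "?e > 0" using that by simp
      moreover have "uniform_limit (cube a s) (\<lambda>n x. \<Sum>k<n. T j k x) (g j) sequentially" for j
        unfolding g_def by (rule Weierstrass_m_test[OF Tle sm'[OF s(1,2)]])
      ultimately have "\<forall>\<^sub>F n in sequentially. \<forall>x\<in>cube a s. dist (\<Sum>k<n. T j k x) (g j x) < ?e" for j
        unfolding uniform_limit_iff by blast
      then have "\<forall>\<^sub>F n in sequentially. \<forall>j. \<forall>x\<in>cube a s. dist (\<Sum>k<n. T j k x) (g j x) < ?e"
        by (simp add: eventually_all_finite)
      then show ?thesis
      proof eventually_elim
        case (elim n)
        show ?case
        proof (intro ballI allI)
          fix x and h :: "real ^ 'm" assume x: "x \<in> cube a s"
          have "(\<Sum>k<n. \<Sum>j\<in>UNIV. h $ j *\<^sub>R T j k x) - (\<Sum>j\<in>UNIV. h $ j *\<^sub>R g j x)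
              = (\<Sum>j\<in>UNIV. h $ j *\<^sub>R ((\<Sum>k<n. T j k x) - g j x))"
            by (subst sum.swap) (simp add: scaleR_sum_right scaleR_diff_right sum_subtractf)
          also have "norm \<dots> \<le> (\<Sum>j\<in>(UNIV :: 'm set). norm h * ?e)"
          proof (rule sum_norm_le)
            fix j
            have "norm ((\<Sum>k<n. T j k x) - g j x) \<le> ?e"
              using elim x by (auto simp: dist_norm less_imp_le)
            then show "norm (h $ j *\<^sub>R ((\<Sum>k<n. T j k x) - g j x)) \<le> norm h * ?e"
              unfolding norm_scaleR real_norm_def by (intro mult_mono component_le_norm_cart) auto
          qed
          also have "\<dots> = e * norm h" by simp
          finally show "norm ((\<Sum>k<n. \<Sum>j\<in>UNIV. h $ j *\<^sub>R T j k x) - (\<Sum>j\<in>UNIV. h $ j *\<^sub>R g j x)) \<le> e * norm h" .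
        qed
      qed
    qed
    obtain F where F: "\<And>x. x \<in> cube a s \<Longrightarrow> (\<lambda>n. (\<Prod>i\<in>UNIV. (x $ i - a $ i) ^ b n i) *\<^sub>R c n) sums F x"
      "\<And>x. x \<in> cube a s \<Longrightarrow> (F has_derivative (\<lambda>h. \<Sum>j\<in>UNIV. h $ j *\<^sub>R g j x)) (at x within cube a s)"
      using has_derivative_series[OF convex_cube 1 2 s(3) f[OF x]] by blast
    \<comment> \<open>The theorem on differentiating series returns a limit function of its own;
      uniqueness of sums identifies it with \<open>f\<close> on the smaller cube.\<close>
    have "F x = f x" if "x \<in> cube a s" for x
      using sums_unique2[OF F(1)[OF that] f] sub that by blast
    moreover have "(F has_derivative (\<lambda>h. \<Sum>j\<in>UNIV. h $ j *\<^sub>R g j x)) (at x)"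
      using F(2)[OF s(3)] by (simp add: at_within_open[OF s(3) open_cube])
    ultimately show ?thesis
      using has_derivative_transform_within_open[OF _ open_cube s(3)] by blast
  qed
  ultimately show ?thesis by (intro exI[of _ g] conjI allI ballI)
qed

lemma power_series_on_Ck_on:
  fixes f :: "real ^ 'm \<Rightarrow> 'b::euclidean_space"
  assumes "power_series_on a \<rho> f"
  shows "Ck_on k (cube a \<rho>) f"
  using assms
proof (induction k arbitrary: f)
  case 0
  from power_series_on_has_derivative[OF 0]
  obtain g where "\<forall>x\<in>cube a \<rho>. (f has_derivative (\<lambda>h. \<Sum>j\<in>UNIV. h $ j *\<^sub>R g j x)) (at x)"
    by (elim exE conjE)
  then have "\<forall>x\<in>cube a \<rho>. isCont f x"
    by - (rule ballI, drule (1) bspec, erule has_derivative_continuous)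
  then have "continuous_on (cube a \<rho>) f" by (rule continuous_at_imp_continuous_on)
  then show ?case by simp
next
  case (Suc k)
  from power_series_on_has_derivative[OF Suc.prems]
  obtain g where g: "\<forall>j. power_series_on a \<rho> (g j)"
    "\<forall>x\<in>cube a \<rho>. (f has_derivative (\<lambda>h. \<Sum>j\<in>UNIV. h $ j *\<^sub>R g j x)) (at x)"
    by (elim exE conjE)
  show ?case
  proof (rule Ck_on_SucI[OF open_cube bspec[OF g(2)]])
    show "Ck_on k (cube a \<rho>) (\<lambda>x. \<Sum>j\<in>UNIV. v $ j *\<^sub>R g j x)" for v
      by (intro Ck_on_sum Ck_on_scaleR Ck_on_const open_cube Suc.IH spec[OF g(1)])
  qed
qed

text \<open>Unordered summability is absolute for reals. The coordinates reduce the vector case to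
  this, as the norm is at most the sum of their absolute values.\<close>

lemma summable_on_norm_vec:
  fixes f :: "'i \<Rightarrow> real ^ 'p"
  assumes "f summable_on I"
  shows "(\<lambda>x. norm (f x)) summable_on I"
proof -
  have "(\<lambda>x. f x $ j) summable_on I" for j
    using summable_on_bounded_linear[OF bounded_linear_vec_nth assms] .
  then have "(\<lambda>x. \<bar>f x $ j\<bar>) summable_on I" for j
    by (subst (asm) summable_on_iff_abs_summable_on_real) simp
  then have "(\<lambda>x. \<Sum>j\<in>J. \<bar>f x $ j\<bar>) summable_on I" for J
    by (induction J rule: infinite_finite_induct) (auto intro: summable_on_add)
  from this[of UNIV] show ?thesis
    by (rule summable_on_comparison_test) (auto simp: norm_le_l1_cart)
qed

lemma real_analytic_imp_power_series_on:
  fixes f :: "real ^ 'm \<Rightarrow> real ^ 'p"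
  assumes "real_analytic_on U f" "a \<in> U"
  obtains \<rho> where "\<rho> > 0" "power_series_on a \<rho> f"
proof -
  from bspec[OF assms(1)[unfolded real_analytic_on_def] assms(2)]
  obtain r c where r: "r > 0" and c0: "\<forall>x\<in>ball a r.
      ((\<lambda>\<alpha>. (\<Prod>i\<in>UNIV. (x $ i - a $ i) ^ \<alpha> i) *\<^sub>R c \<alpha>) has_sum f x) UNIV"
    by (elim exE conjE)
  note c = bspec[OF c0]
  \<comment> \<open>Comparing the Euclidean norm with the sum of the absolute coordinates shows that
    the cube of this half-side lies in the ball of radius \<open>r\<close>.\<close>
  define \<rho> where "\<rho> = r / real CARD('m)"
  have \<rho>: "\<rho> > 0" using r by (simp add: \<rho>_def)
  have ball: "x \<in> ball a r" if "x \<in> cube a \<rho>" for x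
  proof -
    have "norm (x - a) \<le> (\<Sum>i\<in>UNIV. \<bar>(x - a) $ i\<bar>)" by (rule norm_le_l1_cart)
    also have "\<dots> < (\<Sum>i\<in>(UNIV :: 'm set). \<rho>)"
      by (rule sum_strict_mono) (use that in \<open>auto simp: mem_cube\<close>)
    finally show ?thesis by (simp add: \<rho>_def dist_norm norm_minus_commute)
  qed
  \<comment> \<open>The constant multi-indices already form an infinite set; infinity makes the
    enumeration \<open>e\<close> a bijection from the natural numbers.\<close>
  have inf: "infinite (UNIV :: ('m \<Rightarrow> nat) set)"
  proof
    assume "finite (UNIV :: ('m \<Rightarrow> nat) set)"
    then have "finite (range (\<lambda>n::nat. (\<lambda>_::'m. n)))" by (rule finite_subset[rotated]) simp
    then show False by (rule range_inj_infinite[THEN notE, rotated]) (auto simp: inj_def fun_eq_iff)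
  qed
  define e :: "nat \<Rightarrow> 'm \<Rightarrow> nat" where "e = from_nat_into UNIV"
  have bij: "bij_betw e UNIV UNIV"
    unfolding e_def by (rule bij_betw_from_nat_into[OF _ inf]) simp
  have "summable (\<lambda>n. s ^ (\<Sum>i\<in>UNIV. e n i) * norm (c (e n)))" if s: "0 < s" "s < \<rho>" for s
  proof -
    \<comment> \<open>At this diagonal point every monomial equals \<open>s\<close> to the power of
      its total degree, so convergence there is the required majorant.\<close>
    have "a + vec s \<in> cube a \<rho>" using s by (simp add: mem_cube)
    then have "(\<lambda>\<alpha>. s ^ (\<Sum>i\<in>UNIV. \<alpha> i) *\<^sub>R c \<alpha>) summable_on UNIV"
      using c[OF ball] by (force simp: summable_on_def power_sum)
    then have "(\<lambda>\<alpha>. norm (s ^ (\<Sum>i\<in>UNIV. \<alpha> i) *\<^sub>R c \<alpha>)) summable_on UNIV"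
      by (rule summable_on_norm_vec)
    then have "(\<lambda>n. norm (s ^ (\<Sum>i\<in>UNIV. e n i) *\<^sub>R c (e n))) summable_on UNIV"
      using summable_on_reindex_bij_betw[OF bij, of "\<lambda>\<alpha>. norm (s ^ (\<Sum>i\<in>UNIV. \<alpha> i) *\<^sub>R c \<alpha>)"] by simp
    from has_sum_imp_sums[OF has_sum_infsum[OF this]] show ?thesis
      using s by (auto dest: sums_summable)
  qed
  moreover have "(\<lambda>n. (\<Prod>i\<in>UNIV. (x $ i - a $ i) ^ e n i) *\<^sub>R c (e n)) sums f x" if "x \<in> cube a \<rho>" for x
    using c[OF ball[OF that]]
    by (subst (asm) has_sum_reindex_bij_betw[OF bij, symmetric]) (rule has_sum_imp_sums)
  ultimately have "power_series_on a \<rho> f"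
    unfolding power_series_on_def by (intro exI[of _ e] exI[of _ "\<lambda>n. c (e n)"]) auto
  then show thesis using that \<rho> by blast
qed

lemma real_analytic_on_imp_smooth_on:
  assumes "real_analytic_on U f"
  shows "smooth_on U f"
  unfolding smooth_on_def
proof (intro allI Ck_on_locally)
  fix k x assume "x \<in> U"
  then obtain \<rho> where "\<rho> > 0" "power_series_on x \<rho> f"
    using real_analytic_imp_power_series_on[OF assms] by metis
  then show "\<exists>T. open T \<and> x \<in> T \<and> Ck_on k T f"
    by (intro exI[of _ "cube x \<rho>"]) (auto simp: open_cube mem_cube intro: power_series_on_Ck_on)
qed

section \<open>Compactness of the Grassmannian\<close>

lemma closest_point_subspace:
  fixes L :: "'a::euclidean_space set"
  assumes "subspace L" "p \<in> L" "\<And>w. w \<in> L \<Longrightarrow> (v - p) \<bullet> w = 0"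
  shows "closest_point L v = p"
proof (rule closest_point_unique[symmetric])
  show "convex L" "closed L" using assms(1) subspace_imp_convex closed_subspace by blast+
  show "\<forall>z\<in>L. dist v p \<le> dist v z"
  proof
    fix z assume "z \<in> L"
    then have "(v - p) \<bullet> (p - z) = 0" using assms by (simp add: subspace_diff)
    then have "(norm (v - z))\<^sup>2 = (norm (v - p))\<^sup>2 + (norm (p - z))\<^sup>2"
      using norm_add_Pythagorean[of "v - p" "p - z"] by (simp add: orthogonal_def)
    then have "(norm (v - p))\<^sup>2 \<le> (norm (v - z))\<^sup>2" by simp
    then show "dist v p \<le> dist v z" unfolding dist_norm by (rule power2_le_imp_le) simp
  qed
qed (rule assms(2))

text \<open>Makes the projections in \<open>subspace_dist\<close> explicit in terms of a frame, so
  that convergence of frames controls the operator norm.\<close>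

lemma closest_point_span_orthonormal:
  fixes e :: "nat \<Rightarrow> 'a::euclidean_space"
  assumes "\<And>i j. i < d \<Longrightarrow> j < d \<Longrightarrow> e i \<bullet> e j = (if i = j then 1 else 0)"
  shows "closest_point (span (e ` {..<d})) v = (\<Sum>i<d. (v \<bullet> e i) *\<^sub>R e i)"
proof (rule closest_point_subspace)
  show "(\<Sum>i<d. (v \<bullet> e i) *\<^sub>R e i) \<in> span (e ` {..<d})"
    by (intro span_sum span_scale span_base) auto
  fix w assume w: "w \<in> span (e ` {..<d})"
  have "(v - (\<Sum>i<d. (v \<bullet> e i) *\<^sub>R e i)) \<bullet> e j = 0" if "j < d" for j
  proof -
    have "(\<Sum>i<d. (v \<bullet> e i) *\<^sub>R e i) \<bullet> e j = (\<Sum>i<d. if i = j then v \<bullet> e j else 0)"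
      unfolding inner_sum_left by (rule sum.cong) (use assms that in auto)
    then show ?thesis using that by (simp add: inner_diff_left)
  qed
  then show "(v - (\<Sum>i<d. (v \<bullet> e i) *\<^sub>R e i)) \<bullet> w = 0"
    using orthogonal_to_span[OF w, of "v - (\<Sum>i<d. (v \<bullet> e i) *\<^sub>R e i)"] by (auto simp: orthogonal_def)
qed (rule subspace_span)

lemma dim_span_orthonormal:
  fixes e :: "nat \<Rightarrow> 'a::euclidean_space"
  assumes "\<And>i j. i < d \<Longrightarrow> j < d \<Longrightarrow> e i \<bullet> e j = (if i = j then 1 else 0)"
  shows "dim (span (e ` {..<d})) = d"
proof -
  have inj: "inj_on e {..<d}"
    using assms by (intro inj_onI) (metis lessThan_iff zero_neq_one)
  have "pairwise orthogonal (e ` {..<d})" "0 \<notin> e ` {..<d}"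
    using assms by (auto simp: pairwise_def orthogonal_def) (metis inner_zero_left zero_neq_one)
  then have "independent (e ` {..<d})" by (rule pairwise_orthogonal_independent)
  then show ?thesis using card_image[OF inj] by (simp add: dim_eq_card_independent)
qed

lemma subspace_orthonormal_sequence:
  fixes L :: "'a::euclidean_space set"
  assumes "subspace L"
  obtains e :: "nat \<Rightarrow> 'a" where "L = span (e ` {..<dim L})"
    "\<And>i j. i < dim L \<Longrightarrow> j < dim L \<Longrightarrow> e i \<bullet> e j = (if i = j then 1 else 0)"
proof -
  obtain B where B: "pairwise orthogonal B" "\<And>x. x \<in> B \<Longrightarrow> norm x = 1" "independent B" "card B = dim L" "span B = L"
    using orthonormal_basis_subspace[OF assms] by metis
  have "finite B" using B(3) independent_imp_finite by blast
  from ex_bij_betw_nat_finite[OF this] obtain e where e: "bij_betw e {..<dim L} B"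
    unfolding B(4) atLeast0LessThan by blast
  show thesis
  proof (rule that[of e])
    show "L = span (e ` {..<dim L})" using e B(5) by (simp add: bij_betw_def)
    fix i j assume ij: "i < dim L" "j < dim L"
    then have "e i \<in> B" "e j \<in> B" "e i = e j \<longleftrightarrow> i = j"
      using e by (auto simp: bij_betw_def inj_on_def)
    then show "e i \<bullet> e j = (if i = j then 1 else 0)"
      using B(1,2) by (auto simp: pairwise_def orthogonal_def norm_eq_1)
  qed
qed

lemma convergent_subsequence_family:
  fixes f :: "nat \<Rightarrow> nat \<Rightarrow> 'a::heine_borel"
  assumes "\<And>i. i < d \<Longrightarrow> bounded (range (f i))"
  obtains r l where "strict_mono r" "\<And>i. i < d \<Longrightarrow> (\<lambda>n. f i (r n)) \<longlonglongrightarrow> l i"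
  using assms
proof (induction d arbitrary: thesis)
  case 0
  then show ?case using strict_mono_id by blast
next
  case (Suc d)
  obtain r l where r: "strict_mono r" "\<And>i. i < d \<Longrightarrow> (\<lambda>n. f i (r n)) \<longlonglongrightarrow> l i"
    using Suc.IH Suc.prems(2) by (metis less_SucI)
  have "bounded (range (\<lambda>n. f d (r n)))"
    using Suc.prems(2)[of d] by (auto intro: bounded_subset)
  then obtain m s where s: "strict_mono s" "((\<lambda>n. f d (r n)) \<circ> s) \<longlonglongrightarrow> m"
    using bounded_imp_convergent_subsequence by blast
  show ?case
  proof (rule Suc.prems(1))
    show "strict_mono (r \<circ> s)" using r(1) s(1) by (rule strict_mono_o)
    fix i assume "i < Suc d"
    then show "(\<lambda>n. f i ((r \<circ> s) n)) \<longlonglongrightarrow> (l(d := m)) i"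
      using s(2) LIMSEQ_subseq_LIMSEQ[OF r(2)[of i] s(1)] by (auto simp: less_Suc_eq o_def)
  qed
qed

text \<open>Orthonormal frames of the \<open>L n\<close> are bounded, so a subsequence converges
  vector by vector, and the limit frame is orthonormal again and spans \<open>T\<close>. The last
  conclusion is the one through which orthogonality relations pass to the limit.\<close>

lemma grassmann_convergent_subsequence:
  fixes L :: "nat \<Rightarrow> 'a::euclidean_space set"
  assumes L: "\<And>n. L n \<in> grassmannian d"
  obtains r T where "strict_mono r" "grassmann_tendsto (L \<circ> r) T"
    "\<And>v. v \<in> T \<Longrightarrow> \<exists>w. (\<forall>n. w n \<in> L (r n)) \<and> w \<longlonglongrightarrow> v"
proof -
  have "\<forall>n. \<exists>e. L n = span (e ` {..<d}) \<and> (\<forall>i<d. \<forall>j<d. e i \<bullet> e j = (if i = j then 1 else 0))"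
  proof
    fix n
    have "subspace (L n)" "dim (L n) = d" using L[of n] by (auto simp: grassmannian_def)
    with subspace_orthonormal_sequence[of "L n"]
    show "\<exists>e. L n = span (e ` {..<d}) \<and> (\<forall>i<d. \<forall>j<d. e i \<bullet> e j = (if i = j then 1 else 0))"
      by metis
  qed
  then obtain e where span: "\<And>n. L n = span (e n ` {..<d})"
    and on: "\<And>n i j. i < d \<Longrightarrow> j < d \<Longrightarrow> e n i \<bullet> e n j = (if i = j then 1 else 0)"
    by metis
  have n1: "norm (e n i) = 1" if "i < d" for n i using on[OF that that] by (simp add: norm_eq_1)
  then have "bounded (range (\<lambda>n. e n i))" if "i < d" for i
    using that by (auto simp: bounded_iff)
  from convergent_subsequence_family[of d "\<lambda>i n. e n i", OF this]
  obtain r l where r: "strict_mono r" and l: "\<And>i. i < d \<Longrightarrow> (\<lambda>n. e (r n) i) \<longlonglongrightarrow> l i"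
    by auto
  have lon: "l i \<bullet> l j = (if i = j then 1 else 0)" if "i < d" "j < d" for i j
  proof -
    have "(\<lambda>n. e (r n) i \<bullet> e (r n) j) \<longlonglongrightarrow> l i \<bullet> l j"
      by (intro tendsto_inner l that)
    then show ?thesis unfolding on[OF that] by (simp add: tendsto_const_iff)
  qed
  have n1': "norm (l i) = 1" if "i < d" for i using lon[OF that that] by (simp add: norm_eq_1)
  define T where "T = span (l ` {..<d})"
  have cpL: "closest_point (L (r n)) v = (\<Sum>i<d. (v \<bullet> e (r n) i) *\<^sub>R e (r n) i)" for n v
    unfolding span by (rule closest_point_span_orthonormal) (rule on)
  have cpT: "closest_point T v = (\<Sum>i<d. (v \<bullet> l i) *\<^sub>R l i)" for v
    unfolding T_def by (rule closest_point_span_orthonormal) (rule lon)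
  have sub: "subspace T" by (simp add: T_def)
  have "(\<lambda>n. subspace_dist (L (r n)) T) \<longlonglongrightarrow> 0"
  proof (rule tendsto_sandwich[where f = "\<lambda>_. 0" and h = "\<lambda>n. \<Sum>i<d. 2 * norm (e (r n) i - l i)"])
    show "(\<lambda>n. \<Sum>i<d. 2 * norm (e (r n) i - l i)) \<longlonglongrightarrow> 0"
      using l by (intro tendsto_null_sum tendsto_mult_right_zero) (simp add: LIM_zero tendsto_norm_zero)
    have bd: "norm (closest_point (L (r n)) v - closest_point T v) \<le> (\<Sum>i<d. 2 * norm (e (r n) i - l i)) * norm v" for n v
    proof -
      \<comment> \<open>Each frame vector contributes two terms, one for each of its two occurrences
        in the projection formula. The other factor is a unit vector, so each term is at most
        \<open>norm v * norm (e (r n) i - l i)\<close>, whence the factor 2.\<close>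
      have "closest_point (L (r n)) v - closest_point T v
         = (\<Sum>i<d. (v \<bullet> e (r n) i) *\<^sub>R (e (r n) i - l i) + (v \<bullet> (e (r n) i - l i)) *\<^sub>R l i)"
        unfolding cpL cpT by (simp add: algebra_simps sum_subtractf[symmetric] inner_diff_right)
      also have "norm \<dots> \<le> (\<Sum>i<d. 2 * norm (e (r n) i - l i) * norm v)"
      proof (rule sum_norm_le)
        fix i assume "i \<in> {..<d}"
        then have i: "i < d" by simp
        have "\<bar>v \<bullet> e (r n) i\<bar> \<le> norm v" using Cauchy_Schwarz_ineq2[of v "e (r n) i"] n1[OF i] by simp
        then have a: "norm ((v \<bullet> e (r n) i) *\<^sub>R (e (r n) i - l i)) \<le> norm v * norm (e (r n) i - l i)"
          unfolding norm_scaleR by (intro mult_right_mono) auto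
        have b: "norm ((v \<bullet> (e (r n) i - l i)) *\<^sub>R l i) \<le> norm v * norm (e (r n) i - l i)"
          using Cauchy_Schwarz_ineq2[of v "e (r n) i - l i"] n1'[OF i] by simp
        show "norm ((v \<bullet> e (r n) i) *\<^sub>R (e (r n) i - l i) + (v \<bullet> (e (r n) i - l i)) *\<^sub>R l i)
            \<le> 2 * norm (e (r n) i - l i) * norm v"
          by (rule norm_triangle_le) (use a b in \<open>simp add: algebra_simps\<close>)
      qed
      finally show ?thesis by (simp add: sum_distrib_right)
    qed
    show "\<forall>\<^sub>F n in sequentially. subspace_dist (L (r n)) T \<le> (\<Sum>i<d. 2 * norm (e (r n) i - l i))"
      unfolding subspace_dist_def by (intro always_eventually allI onorm_bound bd sum_nonneg) auto
    show "\<forall>\<^sub>F n in sequentially. 0 \<le> subspace_dist (L (r n)) T"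
    proof (intro always_eventually allI)
      fix n
      have "bounded_linear (\<lambda>v. closest_point (L (r n)) v - closest_point T v)"
        unfolding cpL cpT
        by (intro bounded_linear_sub bounded_linear_sum bounded_linear_scaleR_const bounded_linear_inner_left_comp bounded_linear_ident)
      then show "0 \<le> subspace_dist (L (r n)) T"
        unfolding subspace_dist_def by (rule onorm_pos_le)
    qed
  qed auto
  moreover have "T \<in> grassmannian d"
    using sub dim_span_orthonormal[of d l, OF lon] by (simp add: grassmannian_def T_def)
  ultimately have "grassmann_tendsto (L \<circ> r) T"
    using L unfolding grassmann_tendsto_def by auto
  moreover have "\<exists>w. (\<forall>n. w n \<in> L (r n)) \<and> w \<longlonglongrightarrow> v" if "v \<in> T" for v
  \<comment> \<open>The approximating vectors are the projections of \<open>v\<close> to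
    \<open>L (r n)\<close>; they tend to its projection to \<open>T\<close>, which is
    \<open>v\<close>.\<close>
  proof (intro exI conjI allI)
    show "(\<Sum>i<d. (v \<bullet> e (r n) i) *\<^sub>R e (r n) i) \<in> L (r n)" for n
      unfolding span by (intro span_sum span_scale span_base) auto
    have "(\<lambda>n. \<Sum>i<d. (v \<bullet> e (r n) i) *\<^sub>R e (r n) i) \<longlonglongrightarrow> (\<Sum>i<d. (v \<bullet> l i) *\<^sub>R l i)"
      by (intro tendsto_sum tendsto_scaleR tendsto_inner tendsto_const l) auto
    also have "(\<Sum>i<d. (v \<bullet> l i) *\<^sub>R l i) = v"
      using cpT[of v] closest_point_self[OF that] by simp
    finally show "(\<lambda>n. \<Sum>i<d. (v \<bullet> e (r n) i) *\<^sub>R e (r n) i) \<longlonglongrightarrow> v" .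
  qed
  ultimately show thesis by (rule that[OF r])
qed

section \<open>Transversality of small spheres\<close>

lemma eventually_derivative_bound:
  assumes "(f has_derivative f') (at x)" "e > 0"
  shows "\<forall>\<^sub>F y in nhds x. norm (f y - f x - f' (y - x)) \<le> e * norm (y - x)"
  using assms unfolding has_derivative_at_alt eventually_nhds_metric dist_norm by blast

text \<open>Condition (b) is available for distinct strata only, so the stratum containing the
  origin is treated by itself. With \<open>h = \<phi> x - q\<close>, differentiability of
  \<open>\<psi>\<close> at \<open>q\<close> makes \<open>x\<close> close to the derivative of
  \<open>\<psi>\<close> at \<open>q\<close> applied to \<open>h\<close>; continuity of that
  derivative moves the base point from \<open>q\<close> to \<open>\<phi> x\<close>, where the image
  of \<open>h\<close> is tangent.\<close>

lemma submanifold_through_origin_radial: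
  fixes M :: "'a::euclidean_space set"
  assumes "smooth_submanifold d M" "0 \<in> M"
  shows "\<forall>\<^sub>F x in nhds 0. x \<in> M \<and> x \<noteq> 0 \<longrightarrow> (\<exists>u\<in>tangent_space x M. u \<bullet> x \<noteq> 0)"
proof -
  obtain U V \<phi> \<psi> and L :: "'a set" where
    c: "open U" "0 \<in> U" "open V" "homeomorphism U V \<phi> \<psi>" "smooth_on U \<phi>" "smooth_on V \<psi>"
    and L: "subspace L" "\<phi> ` (U \<inter> M) = V \<inter> L"
    using smooth_submanifoldE[OF assms] by metis
  define q where "q = \<phi> 0"
  let ?D = "frechet_derivative \<phi> (at 0)" and ?E = "\<lambda>z. frechet_derivative \<psi> (at z)"
  have \<psi>\<phi>: "\<psi> (\<phi> x) = x" "\<phi> x \<in> V" if "x \<in> U" for x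
    using c(4) that by (auto simp: homeomorphism_def)
  have q: "q \<in> V" "q \<in> L" "\<psi> q = 0"
    using \<psi>\<phi>[OF c(2)] L(2) c(2) assms(2) unfolding q_def by auto
  have D: "(\<phi> has_derivative ?D) (at 0)" using smooth_on_differentiable[OF c(5,2)] .
  have E: "(\<psi> has_derivative ?E z) (at z)" if "z \<in> V" for z
    using smooth_on_differentiable[OF c(6) that] .
  obtain K where K: "\<And>x. norm (?D x) \<le> norm x * K" "K > 0"
    using bounded_linear.pos_bounded[OF has_derivative_bounded_linear[OF D]] by blast
  \<comment> \<open>Lipschitz constant of \<open>\<phi>\<close> at the origin: \<open>K\<close>
    bounds the derivative, and 1 is the error allowed in \<open>e3\<close>.\<close>
  define C where "C = 1 + K"
  have C: "C > 0" using K(2) by (simp add: C_def)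
  \<comment> \<open>Two errors of size \<open>\<eta> * norm h\<close> occur, and
    \<open>norm h\<close> is at most \<open>C * norm x\<close>; together they amount to half of
    \<open>norm x\<close>.\<close>
  define \<eta> where "\<eta> = 1 / (4 * C)"
  have \<eta>: "\<eta> > 0" using C by (simp add: \<eta>_def)
  have lim: "filterlim \<phi> (nhds q) (nhds 0)"
    using has_derivative_continuous[OF D] unfolding q_def continuous_at tendsto_at_iff_tendsto_nhds .
  have "((\<lambda>z. \<Sum>b\<in>Basis. norm (?E z b - ?E q b)) \<longlongrightarrow> (\<Sum>b\<in>Basis. norm (?E q b - ?E q b))) (nhds q)"
  proof (intro tendsto_sum tendsto_norm tendsto_diff tendsto_const)
    fix b :: 'a
    have "Ck_on 1 V \<psi>" using c(6) by (simp add: smooth_on_def)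
    then have "continuous_on V (\<lambda>z. ?E z b)" by simp
    then have "isCont (\<lambda>z. ?E z b) q"
      using c(3) q(1) continuous_on_eq_continuous_at by blast
    then show "((\<lambda>z. ?E z b) \<longlongrightarrow> ?E q b) (nhds q)"
      unfolding continuous_at tendsto_at_iff_tendsto_nhds[of "\<lambda>z. ?E z b" q] .
  qed
  then have "((\<lambda>z. \<Sum>b\<in>Basis. norm (?E z b - ?E q b)) \<longlongrightarrow> 0) (nhds q)" by simp
  from order_tendstoD(2)[OF this \<eta>]
  have e1: "\<forall>\<^sub>F z in nhds q. (\<Sum>b\<in>Basis. norm (?E z b - ?E q b)) < \<eta>" .
  have e2: "\<forall>\<^sub>F z in nhds q. norm (\<psi> z - \<psi> q - ?E q (z - q)) \<le> \<eta> * norm (z - q)"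
    by (rule eventually_derivative_bound[OF E[OF q(1)] \<eta>])
  have e3: "\<forall>\<^sub>F x in nhds 0. norm (\<phi> x - \<phi> 0 - ?D (x - 0)) \<le> 1 * norm (x - 0)"
    by (rule eventually_derivative_bound[OF D]) simp
  have e4: "\<forall>\<^sub>F x in nhds 0. x \<in> U" using c(1,2) by (rule eventually_nhds_in_open)
  from eventually_compose_filterlim[OF e1 lim] eventually_compose_filterlim[OF e2 lim] e3 e4
  show ?thesis
  proof eventually_elim
    case (elim x)
    show ?case
    proof
      assume x: "x \<in> M \<and> x \<noteq> 0"
      \<comment> \<open>The tangent vector \<open>u\<close> is the chart image of the ray to \<open>\<phi> x\<close>; it differs from \<open>x\<close> by
        at most half the norm of \<open>x\<close>.\<close>
      define h where "h = \<phi> x - q"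
      define u where "u = ?E (\<phi> x) h"
      have "\<phi> x \<in> L" using L(2) x elim(4) by blast
      then have "h \<in> L" using q(2) L(1) by (simp add: h_def subspace_diff)
      then have "u \<in> tangent_space x M"
        using tangent_space_chart[OF c(1) elim(4) c(3-6) _ L] x by (simp add: u_def)
      moreover have "norm h \<le> C * norm x"
      proof -
        have "norm h \<le> norm (\<phi> x - \<phi> 0 - ?D x) + norm (?D x)"
          using norm_triangle_ineq[of "\<phi> x - \<phi> 0 - ?D x" "?D x"] by (simp add: h_def q_def)
        also have "\<dots> \<le> norm x + norm x * K" using elim(3) K(1)[of x] by simp
        finally show ?thesis by (simp add: C_def algebra_simps)
      qed
      moreover have "norm (u - ?E q h) \<le> \<eta> * norm h"
      proof -
        have lin: "linear (?E (\<phi> x))" "linear (?E q)"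
          using E q(1) \<psi>\<phi>(2)[OF elim(4)] has_derivative_linear by blast+
        have ex: "f h = (\<Sum>b\<in>Basis. (h \<bullet> b) *\<^sub>R f b)" if "linear f" for f :: "'a \<Rightarrow> 'a"
        proof -
          have "f h = f (\<Sum>b\<in>Basis. (h \<bullet> b) *\<^sub>R b)" by (simp add: euclidean_representation)
          then show ?thesis using that by (simp add: linear_sum linear_scale)
        qed
        have "u - ?E q h = (\<Sum>b\<in>Basis. (h \<bullet> b) *\<^sub>R (?E (\<phi> x) b - ?E q b))"
          unfolding u_def ex[OF lin(1)] ex[OF lin(2)] by (simp add: scaleR_diff_right sum_subtractf)
        also have "norm \<dots> \<le> (\<Sum>b\<in>Basis. norm h * norm (?E (\<phi> x) b - ?E q b))"
          by (rule sum_norm_le) (auto intro!: mult_right_mono Basis_le_norm)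
        also have "\<dots> = norm h * (\<Sum>b\<in>Basis. norm (?E (\<phi> x) b - ?E q b))"
          by (simp add: sum_distrib_left)
        also have "\<dots> \<le> norm h * \<eta>" using elim(1) by (intro mult_left_mono) auto
        finally show ?thesis by (simp add: mult.commute)
      qed
      moreover have "norm (x - ?E q h) \<le> \<eta> * norm h"
        using elim(2) \<psi>\<phi>(1)[OF elim(4)] q(3) by (simp add: h_def)
      ultimately have "norm (u - x) \<le> \<eta> * (C * norm x) + \<eta> * (C * norm x)"
      proof -
        assume hC: "norm h \<le> C * norm x"
          and *: "norm (u - ?E q h) \<le> \<eta> * norm h" "norm (x - ?E q h) \<le> \<eta> * norm h"
        have "\<eta> * norm h \<le> \<eta> * (C * norm x)" using hC \<eta> by (intro mult_left_mono) auto
        moreover have "norm (u - x) \<le> norm (u - ?E q h) + norm (x - ?E q h)"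
          using norm_triangle_ineq4[of "u - ?E q h" "x - ?E q h"] by simp
        ultimately show ?thesis using * by linarith
      qed
      then have "norm (u - x) \<le> norm x / 2" using C by (simp add: \<eta>_def)
      \<comment> \<open>By the Cauchy-Schwarz inequality \<open>u \<bullet> x\<close> is then at
        least half of \<open>x \<bullet> x\<close>.\<close>
      then have "norm (u - x) * norm x \<le> norm x / 2 * norm x"
        by (intro mult_right_mono) auto
      moreover have "- ((u - x) \<bullet> x) \<le> norm (u - x) * norm x"
        using Cauchy_Schwarz_ineq2[of "u - x" x] by simp
      moreover have "norm x * norm x = x \<bullet> x" by (simp add: dot_square_norm power2_eq_square)
      moreover have "x \<bullet> x > 0" using x by simp
      ultimately have "u \<bullet> x > 0" unfolding inner_diff_left by (simp only: times_divide_eq_left)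
      with \<open>u \<in> tangent_space x M\<close> show "\<exists>u\<in>tangent_space x M. u \<bullet> x \<noteq> 0" by force
    qed
  qed
qed

lemma grassmann_tendsto_subseq:
  assumes "grassmann_tendsto L T" "strict_mono r"
  shows "grassmann_tendsto (\<lambda>n. L (r n)) T"
  using assms LIMSEQ_subseq_LIMSEQ[OF _ assms(2), of "\<lambda>n. subspace_dist (L n) T" 0]
  unfolding grassmann_tendsto_def o_def by blast

lemma not_eventually_nhds_sequence:
  fixes x :: "'a::metric_space"
  assumes "\<not> (\<forall>\<^sub>F y in nhds x. P y)"
  shows "\<exists>y. y \<longlonglongrightarrow> x \<and> (\<forall>n. \<not> P (y n))"
proof -
  have "\<forall>n. \<exists>y. dist y x < inverse (real (Suc n)) \<and> \<not> P y"
    using assms unfolding eventually_nhds_metric by (metis inverse_positive_iff_positive of_nat_0_less_iff zero_less_Suc)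
  then obtain y where y: "\<And>n. dist (y n) x < inverse (real (Suc n))" "\<And>n. \<not> P (y n)" by metis
  have "(\<lambda>n. dist (y n) x) \<longlonglongrightarrow> 0"
    by (rule tendsto_sandwich[OF _ _ tendsto_const LIMSEQ_inverse_real_of_nat])
      (use y(1) in \<open>auto intro!: always_eventually less_imp_le\<close>)
  then have "y \<longlonglongrightarrow> x" using tendsto_dist_iff by blast
  then show ?thesis using y(2) by blast
qed

text \<open>If \<open>W\<close> does not accumulate at the origin the claim is vacuous near 0.
  Otherwise a failing sequence requires two successive extractions, one for the tangent spaces and
  one for the radial lines, because condition (b) takes both limits as given.\<close>

lemma whitney_b_radial:
  fixes W :: "'a::euclidean_space set"
  assumes W: "smooth_submanifold d W" and b: "whitney_b W Y" and Y: "0 \<in> Y" "0 \<notin> W"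
  shows "\<forall>\<^sub>F x in nhds 0. x \<in> W \<longrightarrow> (\<exists>u\<in>tangent_space x W. u \<bullet> x \<noteq> 0)"
proof (rule ccontr)
  assume "\<not> ?thesis"
  from not_eventually_nhds_sequence[OF this]
  obtain x where x: "x \<longlonglongrightarrow> 0" and "\<forall>n. \<not> (x n \<in> W \<longrightarrow> (\<exists>u\<in>tangent_space (x n) W. u \<bullet> x n \<noteq> 0))"
    by (elim exE conjE)
  then have xW: "\<And>n. x n \<in> W" and orth: "\<And>n u. u \<in> tangent_space (x n) W \<Longrightarrow> u \<bullet> x n = 0"
    by blast+
  have x0: "x n \<noteq> 0" for n using xW Y(2) by metis
  have "tangent_space (x n) W \<in> grassmannian d" for n
    using tangent_space_submanifold[OF W xW] by (simp add: grassmannian_def)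
  from grassmann_convergent_subsequence[of "\<lambda>n. tangent_space (x n) W", OF this]
  obtain r T where r: "strict_mono r" "grassmann_tendsto (\<lambda>n. tangent_space (x (r n)) W) T"
    and T: "\<And>v. v \<in> T \<Longrightarrow> \<exists>w. (\<forall>n. w n \<in> tangent_space (x (r n)) W) \<and> w \<longlonglongrightarrow> v"
    unfolding o_def by metis
  have "span {x (r n)} \<in> grassmannian 1" for n
    using x0 by (simp add: grassmannian_def dim_singleton)
  from grassmann_convergent_subsequence[of "\<lambda>n. span {x (r n)}", OF this]
  obtain s l where s: "strict_mono s" "grassmann_tendsto (\<lambda>n. span {x (r (s n))}) l"
    and l: "\<And>v. v \<in> l \<Longrightarrow> \<exists>w. (\<forall>n. w n \<in> span {x (r (s n))}) \<and> w \<longlonglongrightarrow> v"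
    unfolding o_def by metis
  let ?x = "\<lambda>n. x (r (s n))"
  have lim: "?x \<longlonglongrightarrow> 0"
    using LIMSEQ_subseq_LIMSEQ[OF LIMSEQ_subseq_LIMSEQ[OF x r(1)] s(1)] by (simp add: o_def)
  \<comment> \<open>Condition (b) is used for secants ending at the constant point \<open>0\<close>.\<close>
  have "l \<subseteq> T"
    using b[unfolded whitney_b_def, THEN bspec, OF Y(1), THEN spec[of _ ?x], THEN spec[of _ "\<lambda>_. 0"],
        THEN spec[of _ T], THEN spec[of _ l]]
      lim grassmann_tendsto_subseq[OF r(2) s(1)] s(2) xW x0 Y(1) by simp
  \<comment> \<open>A limit of lines is a line, so it contains some \<open>u \<noteq> 0\<close>.
    Approximating \<open>u\<close> by tangent vectors and by radial vectors makes
    \<open>u \<bullet> u\<close> a limit of inner products that all vanish.\<close>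
  have "l \<noteq> {0}"
    using s(2) dim_eq_0[of l] by (auto simp: grassmann_tendsto_def grassmannian_def dim_singleton x0)
  moreover have "0 \<in> l" using s(2) by (auto simp: grassmann_tendsto_def grassmannian_def subspace_0)
  ultimately obtain u where u: "u \<in> l" "u \<noteq> 0" by blast
  from l[OF u(1)] obtain v where v: "\<forall>n. v n \<in> span {?x n}" "v \<longlonglongrightarrow> u"
    by (elim exE conjE)
  from T[OF subsetD[OF \<open>l \<subseteq> T\<close> u(1)]]
  obtain w where w: "\<forall>n. w n \<in> tangent_space (x (r n)) W" "w \<longlonglongrightarrow> u"
    by (elim exE conjE)
  have "(\<lambda>n. w (s n)) \<longlonglongrightarrow> u"
    using LIMSEQ_subseq_LIMSEQ[OF w(2) s(1)] by (simp add: o_def)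
  from tendsto_inner[OF this v(2)] have "(\<lambda>n. w (s n) \<bullet> v n) \<longlonglongrightarrow> u \<bullet> u" .
  moreover have "w (s n) \<bullet> v n = 0" for n
  proof -
    obtain k where "v n = k *\<^sub>R ?x n" using spec[OF v(1), of n] by (auto simp: span_singleton)
    then show ?thesis using orth[OF spec[OF w(1)]] by simp
  qed
  ultimately show False using u(2) by (simp add: tendsto_const_iff)
qed

text \<open>The kernel is the orthogonal complement of the range of the adjoint, and the adjoint of
  a surjection is injective.\<close>

lemma dim_kernel_surj:
  fixes f :: "'a::euclidean_space \<Rightarrow> 'b::euclidean_space"
  assumes "linear f" "surj f"
  shows "dim {v. f v = 0} + DIM('b) = DIM('a)"
proof -
  let ?A = "range (adjoint f)"
  have lin: "linear (adjoint f)" by (rule adjoint_linear[OF assms(1)])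
  have "inj (adjoint f)"
  proof (subst linear_injective_0[OF lin], intro allI impI)
    fix y assume "adjoint f y = 0"
    then have "f x \<bullet> y = 0" for x by (simp flip: adjoint_works[OF assms(1)])
    then show "y = 0" using assms(2) by (metis inner_eq_zero_iff surjD)
  qed
  then have "dim ?A = DIM('b)"
    using dim_image_eq[OF lin, of UNIV] by simp
  moreover have "{v. f v = 0} = {y \<in> UNIV. \<forall>x\<in>?A. orthogonal x y}"
  proof -
    have "f v = 0 \<longleftrightarrow> (\<forall>y. f v \<bullet> y = 0)" for v by (metis inner_eq_zero_iff inner_zero_left)
    then show ?thesis
      by (simp add: orthogonal_def inner_commute[of "adjoint f _"] adjoint_works[OF assms(1)])
  qed
  moreover have "subspace ?A" by (rule linear_subspace_image[OF lin subspace_UNIV])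
  ultimately show ?thesis
    using dim_subspace_orthogonal_to_vectors[of ?A UNIV] by simp
qed

text \<open>The sphere is a fibre of the submersion \<open>y \<bullet> y\<close> near
  \<open>x\<close>, and its tangent space contains the hyperplane orthogonal to \<open>x\<close>;
  one tangent vector of the other fibre outside this hyperplane therefore spans the rest.\<close>

lemma transverse_sphere_fibre:
  fixes f :: "real ^ 'n \<Rightarrow> 'b::euclidean_space"
  assumes S: "open S" "x \<in> S" and f: "smooth_on S f" "surj (frechet_derivative f (at x))"
    and x: "x \<in> sphere 0 \<epsilon>" and v: "frechet_derivative f (at x) v = 0" "v \<bullet> x \<noteq> 0"
  shows "transverse_at (sphere 0 \<epsilon>) {y \<in> S. f y = f x} x"
proof -
  let ?g = "\<lambda>y :: real ^ 'n. y \<bullet> y" and ?F = "{y \<in> S. f y = f x}"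
  have x0: "x \<noteq> 0" using v(2) by auto
  have g: "smooth_on UNIV ?g"
    unfolding smooth_on_def by (intro allI Ck_on_inner Ck_on_linear open_UNIV bounded_linear_ident)
  have "(?g has_derivative (\<lambda>h. 2 * (x \<bullet> h))) (at x)"
    by (auto intro!: derivative_eq_intros simp: inner_commute)
  then have g': "frechet_derivative ?g (at x) = (\<lambda>h. 2 * (x \<bullet> h))"
    by (rule frechet_derivative_at[symmetric])
  have "surj (frechet_derivative ?g (at x))"
    unfolding g' by (rule surjI[of _ "\<lambda>c. (c / (2 * (x \<bullet> x))) *\<^sub>R x"]) (use x0 in simp)
  moreover have eq: "{y \<in> UNIV. ?g y = ?g x} = sphere 0 \<epsilon>"
    using x by (auto simp: dist_norm norm_eq_sqrt_inner)
  ultimately obtain W1 d1 where 1: "open W1" "x \<in> W1" "smooth_submanifold d1 (W1 \<inter> sphere 0 \<epsilon>)"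
    "{h. 2 * (x \<bullet> h) = 0} \<subseteq> tangent_space x (sphere 0 \<epsilon>)"
    using submersion_fibre[OF open_UNIV UNIV_I g, of x] unfolding g' eq by metis
  obtain W2 d2 where 2: "open W2" "x \<in> W2" "smooth_submanifold d2 (W2 \<inter> ?F)"
    "{v. frechet_derivative f (at x) v = 0} \<subseteq> tangent_space x ?F"
    using submersion_fibre[OF S f] by metis
  let ?W = "W1 \<inter> W2"
  have "?W \<inter> sphere 0 \<epsilon> = W2 \<inter> (W1 \<inter> sphere 0 \<epsilon>)" "?W \<inter> ?F = W1 \<inter> (W2 \<inter> ?F)" by auto
  then have "smooth_submanifold d1 (?W \<inter> sphere 0 \<epsilon>)" "smooth_submanifold d2 (?W \<inter> ?F)"
    using smooth_submanifold_open_subset 1(1,3) 2(1,3) by metis+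
  moreover have "open ?W" "x \<in> ?W" using 1(1,2) 2(1,2) by auto
  moreover have "x \<in> sphere 0 \<epsilon> \<inter> ?F" using x S(2) by simp
  moreover have "w \<in> {a + b |a b. a \<in> tangent_space x (sphere 0 \<epsilon>) \<and> b \<in> tangent_space x ?F}" for w
  proof -
    \<comment> \<open>This coefficient makes \<open>w - c *\<^sub>R v\<close> orthogonal to
      \<open>x\<close>.\<close>
    define c where "c = (w \<bullet> x) / (v \<bullet> x)"
    have lin: "linear (frechet_derivative f (at x))"
      using has_derivative_linear[OF smooth_on_differentiable[OF f(1) S(2)]] .
    have "w - c *\<^sub>R v \<in> tangent_space x (sphere 0 \<epsilon>)"
      using 1(4) v(2) by (auto simp: c_def inner_diff_right inner_commute)
    moreover have "c *\<^sub>R v \<in> tangent_space x ?F"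
      using 2(4) v(1) by (auto simp: linear_scale[OF lin])
    moreover have "w = (w - c *\<^sub>R v) + c *\<^sub>R v" by simp
    ultimately show ?thesis by blast
  qed
  ultimately show ?thesis unfolding transverse_at_def by blast
qed

text \<open>Each stratum has its own neighbourhood of the origin. By local finiteness only finitely
  many strata come near 0, so one neighbourhood serves them all.\<close>

lemma whitney_stratification_radial:
  fixes \<W> :: "'a::euclidean_space set set"
  assumes strat: "stratification Z \<W>" and "0 \<in> Z"
    and b: "\<And>X Y. X \<in> \<W> \<Longrightarrow> Y \<in> \<W> \<Longrightarrow> X \<noteq> Y \<Longrightarrow> whitney_b X Y"
  shows "\<forall>\<^sub>F x in nhds 0. \<forall>W\<in>\<W>. x \<in> W \<and> x \<noteq> 0 \<longrightarrow> (\<exists>u\<in>tangent_space x W. u \<bullet> x \<noteq> 0)"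
proof -
  have part: "partition_on Z \<W>" and lf: "locally_finite_in (top_of_set Z) \<W>"
    and sm: "\<And>X. X \<in> \<W> \<Longrightarrow> \<exists>d. smooth_submanifold d X"
    using strat by (auto simp: stratification_def)
  obtain Y where Y: "Y \<in> \<W>" "0 \<in> Y"
    using partition_onD1[OF part] \<open>0 \<in> Z\<close> by blast
  obtain V where V: "openin (top_of_set Z) V" "0 \<in> V" "finite {W \<in> \<W>. W \<inter> V \<noteq> {}}"
    using lf \<open>0 \<in> Z\<close> unfolding locally_finite_in_def by auto
  obtain B where B: "open B" "V = Z \<inter> B" using V(1) by (auto simp: openin_open)
  have "\<forall>\<^sub>F x in nhds 0. x \<in> W \<and> x \<noteq> 0 \<longrightarrow> (\<exists>u\<in>tangent_space x W. u \<bullet> x \<noteq> 0)" if W: "W \<in> \<W>" for W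
  proof -
    obtain d where d: "smooth_submanifold d W" using sm[OF W] by blast
    show ?thesis
    proof (cases "W = Y")
      case True
      then show ?thesis using submanifold_through_origin_radial[OF d] Y(2) by simp
    next
      case False
      then have "0 \<notin> W" using partition_onD2[OF part] W Y by (auto simp: disjoint_def)
      from whitney_b_radial[OF d b[OF W Y(1) False] Y(2) this]
      show ?thesis by (rule eventually_mono) blast
    qed
  qed
  then have "\<forall>\<^sub>F x in nhds 0. \<forall>W\<in>{W \<in> \<W>. W \<inter> V \<noteq> {}}. x \<in> W \<and> x \<noteq> 0 \<longrightarrow> (\<exists>u\<in>tangent_space x W. u \<bullet> x \<noteq> 0)"
    by (intro eventually_ball_finite V(3)) blast
  moreover have "\<forall>\<^sub>F x in nhds 0. x \<in> B"
    using B V(2) by (intro eventually_nhds_in_open) auto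
  ultimately show ?thesis
  proof eventually_elim
    case (elim x)
    show ?case
    proof (intro ballI impI)
      fix W assume W: "W \<in> \<W>" "x \<in> W \<and> x \<noteq> 0"
      then have "x \<in> Z" using partition_onD1[OF part] by blast
      then have "W \<inter> V \<noteq> {}" using W elim(2) B(2) by blast
      then show "\<exists>u\<in>tangent_space x W. u \<bullet> x \<noteq> 0" using W elim(1) by blast
    qed
  qed
qed

lemma not_Sing_imp_surj:
  fixes G :: "real ^ 'm \<Rightarrow> real ^ 'p"
  assumes "CARD('m) \<ge> CARD('p)" "x \<in> U" "x \<notin> Sing U G" "G differentiable at x"
  shows "surj (frechet_derivative G (at x))"
proof -
  have lin: "linear (frechet_derivative G (at x))"
    using assms(4) by (rule linear_frechet_derivative)
  have "rank (matrix (frechet_derivative G (at x))) = CARD('p)"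
    using assms(1-3) by (simp add: Sing_def jacobian_def)
  then show ?thesis
    unfolding full_rank_surjective matrix_vector_mul(2)[OF lin] .
qed

text \<open>Regularity of \<open>y\<close> is placed inside the eventual statement so that a
  sequence violating it consists of regular points, with kernels of the common dimension m -
  p.\<close>

lemma thom_condition_radial:
  fixes G :: "real ^ 'm \<Rightarrow> real ^ 'p"
  assumes thom: "thom_condition G X W" and x: "x \<in> W"
    and u: "u \<in> tangent_space x W" "u \<bullet> x \<noteq> 0"
  shows "\<forall>\<^sub>F y in nhds x. y \<in> X \<and> G differentiable at y \<and> surj (frechet_derivative G (at y))
    \<longrightarrow> (\<exists>v. frechet_derivative G (at y) v = 0 \<and> v \<bullet> y \<noteq> 0)"
proof (rule ccontr)
  let ?K = "\<lambda>y. {v. frechet_derivative G (at y) v = 0}"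
  assume "\<not> ?thesis"
  from not_eventually_nhds_sequence[OF this]
  obtain y where lim: "y \<longlonglongrightarrow> x" and y: "\<forall>n. \<not> (y n \<in> X \<and> G differentiable at (y n)
      \<and> surj (frechet_derivative G (at (y n)))
    \<longrightarrow> (\<exists>v. frechet_derivative G (at (y n)) v = 0 \<and> v \<bullet> y n \<noteq> 0))"
    by (elim exE conjE)
  from y have yX: "\<And>n. y n \<in> X" and diff: "\<And>n. G differentiable at (y n)"
    and surj: "\<And>n. surj (frechet_derivative G (at (y n)))"
    and orth: "\<And>n v. v \<in> ?K (y n) \<Longrightarrow> v \<bullet> y n = 0"
    by blast+
  have lin: "linear (frechet_derivative G (at (y n)))" for n
    by (rule linear_frechet_derivative[OF diff])
  have "?K (y n) \<in> grassmannian (CARD('m) - CARD('p))" for n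
    using dim_kernel_surj[OF lin surj, of n]
    by (simp add: grassmannian_def subspace_def linear_0[OF lin] linear_add[OF lin] linear_scale[OF lin])
  from grassmann_convergent_subsequence[of "\<lambda>n. ?K (y n)", OF this]
  obtain r T where r: "strict_mono r" "grassmann_tendsto (\<lambda>n. ?K (y (r n))) T"
    and T: "\<And>v. v \<in> T \<Longrightarrow> \<exists>w. (\<forall>n. w n \<in> ?K (y (r n))) \<and> w \<longlonglongrightarrow> v"
    unfolding o_def by metis
  have limr: "(\<lambda>n. y (r n)) \<longlonglongrightarrow> x"
    using LIMSEQ_subseq_LIMSEQ[OF lim r(1)] by (simp add: o_def)
  have "tangent_space x W \<subseteq> T"
    using thom[unfolded thom_condition_def, THEN bspec, OF x, THEN spec[of _ "\<lambda>n. y (r n)"], THEN spec[of _ T]]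
      yX limr r(2) by simp
  from T[OF subsetD[OF this u(1)]]
  obtain w where w: "\<forall>n. w n \<in> ?K (y (r n))" "w \<longlonglongrightarrow> u"
    by (elim exE conjE)
  from tendsto_inner[OF w(2) limr] have "(\<lambda>n. w n \<bullet> y (r n)) \<longlonglongrightarrow> u \<bullet> x" .
  then show False using orth[OF spec[OF w(1)]] u(2) by (simp add: tendsto_const_iff)
qed

theorem proposition3p5:
  fixes G :: "real ^ 'm \<Rightarrow> real ^ 'p" and U :: "(real ^ 'm) set"
  assumes "CARD('m) \<ge> CARD('p)" and "CARD('p) \<ge> 2"
    and "analytic_germ_rep U G"
    and "nonconstant_germ G"
    and "isolated_critical_value U G"
    and "thom_regular U G"
  shows "\<exists>\<epsilon>\<^sub>0>0. \<forall>\<epsilon>. 0 < \<epsilon> \<and> \<epsilon> < \<epsilon>\<^sub>0 \<longrightarrow>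
           (\<exists>N \<subseteq> sphere 0 \<epsilon>.
              (\<exists>O'. openin (top_of_set (sphere 0 \<epsilon>)) O' \<and> sphere 0 \<epsilon> \<inter> zero_locus U G \<subseteq> O' \<and> O' \<subseteq> N) \<and>
              (\<forall>x \<in> N - zero_locus U G. transverse_at (sphere 0 \<epsilon>) {y\<in>U. G y = G x} x))"
proof -
  let ?V = "zero_locus U G"
  have U: "open U" "0 \<in> U" "G 0 = 0" and G: "smooth_on U G"
    using assms(3) real_analytic_on_imp_smooth_on by (auto simp: analytic_germ_rep_def)
  have diff: "G differentiable at y" if "y \<in> U" for y
    using smooth_on_differentiable[OF G that] by (rule differentiableI)
  obtain \<delta> \<W> where \<delta>: "\<delta> > 0" "ball 0 \<delta> \<subseteq> U"
    and strat: "stratification (?V \<inter> ball 0 \<delta>) \<W>"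
    and whit: "whitney_stratification (ball 0 \<delta>) ({ball 0 \<delta> - ?V} \<union> \<W>)"
    and thom: "\<And>W. W \<in> \<W> \<Longrightarrow> thom_condition G (ball 0 \<delta> - ?V) W"
    using assms(6) unfolding thom_regular_def by metis
  have "0 \<in> ?V \<inter> ball 0 \<delta>" using U \<delta>(1) by (simp add: zero_locus_def)
  moreover have "whitney_b X Y" if "X \<in> \<W>" "Y \<in> \<W>" "X \<noteq> Y" for X Y
    using whit that by (simp add: whitney_stratification_def)
  ultimately obtain e1 where e1: "e1 > 0" and radial: "\<And>x W. norm x < e1 \<Longrightarrow> W \<in> \<W> \<Longrightarrow> x \<in> W \<Longrightarrow> x \<noteq> 0
      \<Longrightarrow> \<exists>u\<in>tangent_space x W. u \<bullet> x \<noteq> 0"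
    using whitney_stratification_radial[OF strat] unfolding eventually_nhds_metric dist_norm by auto
  have "\<forall>\<^sub>F r in at_right (0::real). 0 < r \<and> same_set_germ (Disc (U \<inter> ball 0 r) G) {0}"
    using assms(5) eventually_at_right_less unfolding isolated_critical_value_def
    by (rule eventually_conj[rotated])
  then obtain r where r: "r > 0" "same_set_germ (Disc (U \<inter> ball 0 r) G) {0}"
    using eventually_happens'[OF trivial_limit_at_right_real] by blast
  show ?thesis
  \<comment> \<open>The three bounds keep the sphere inside the stratified ball, inside the region
    where strata have non-orthogonal tangent vectors, and inside the representative whose
    discriminant is {0} near 0.\<close>
  proof (intro exI[of _ "min \<delta> (min e1 r)"] conjI allI impI)
    show "0 < min \<delta> (min e1 r)" using \<delta>(1) e1 r(1) by simp
    fix \<epsilon> :: real assume "0 < \<epsilon> \<and> \<epsilon> < min \<delta> (min e1 r)"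
    then have \<epsilon>: "0 < \<epsilon>" "\<epsilon> < \<delta>" "\<epsilon> < e1" "\<epsilon> < r" by auto
    \<comment> \<open>The implication makes \<open>P\<close> a subset of the whole space that
      contains all points off the sphere or on the zero locus, so the ordinary interior can be
      used.\<close>
    define P where "P = {y. y \<in> sphere 0 \<epsilon> - ?V \<longrightarrow> transverse_at (sphere 0 \<epsilon>) {z\<in>U. G z = G y} y}"
    have "x \<in> interior P" if x: "x \<in> sphere 0 \<epsilon>" "x \<in> ?V" for x
    proof -
      have nx: "norm x = \<epsilon>" using x(1) by simp
      have "x \<in> \<Union>\<W>"
        using strat x nx \<epsilon>(2) partition_onD1[of "?V \<inter> ball 0 \<delta>" \<W>] by (auto simp: stratification_def)
      then obtain W where W: "W \<in> \<W>" "x \<in> W" by blast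
      obtain u where u: "u \<in> tangent_space x W" "u \<bullet> x \<noteq> 0"
        using radial[OF _ W] nx \<epsilon>(1,3) by force
      have Gx: "x \<in> U" "G x = 0" using x(2) by (auto simp: zero_locus_def)
      have "isCont G x" using diff[OF Gx(1)] by (rule differentiable_imp_continuous_within)
      then have "filterlim G (nhds 0) (nhds x)"
        unfolding continuous_at tendsto_at_iff_tendsto_nhds Gx(2)[symmetric] .
      \<comment> \<open>The equality of set germs at 0 is pulled back along \<open>G\<close>, which
        is continuous at \<open>x\<close> with \<open>G x = 0\<close>; it thus applies at points far
        from the origin of the source.\<close>
      from eventually_compose_filterlim[OF r(2)[unfolded same_set_germ_def] this]
      have "\<forall>\<^sub>F y in nhds x. G y \<in> Disc (U \<inter> ball 0 r) G \<longleftrightarrow> G y \<in> {0}" .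
      moreover have "\<forall>\<^sub>F y in nhds x. y \<in> ball 0 \<delta>"
        using nx \<epsilon>(2) by (intro eventually_nhds_in_open) auto
      moreover note thom_condition_radial[OF thom[OF W(1)] W(2) u]
      ultimately have "\<forall>\<^sub>F y in nhds x. y \<in> P"
      proof eventually_elim
        case (elim y)
        show ?case
          unfolding P_def mem_Collect_eq
        proof
          assume y: "y \<in> sphere 0 \<epsilon> - ?V"
          have yU: "y \<in> U" using elim(2) \<delta>(2) by blast
          then have "G y \<noteq> 0" using y by (simp add: zero_locus_def)
          then have "y \<notin> Sing (U \<inter> ball 0 r) G" using elim(1) by (auto simp: Disc_def)
          then have "surj (frechet_derivative G (at y))"
            using not_Sing_imp_surj[OF assms(1), of y "U \<inter> ball 0 r" G] yU y \<epsilon>(4) diff[OF yU] by simp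
          moreover from this obtain v where "frechet_derivative G (at y) v = 0" "v \<bullet> y \<noteq> 0"
            using elim(2,3) y diff[OF yU] by auto
          ultimately show "transverse_at (sphere 0 \<epsilon>) {z\<in>U. G z = G y} y"
            using transverse_sphere_fibre[OF U(1) yU G] y by blast
        qed
      qed
      then show ?thesis
        unfolding eventually_nhds by (metis interiorI subsetI)
    qed
    \<comment> \<open>The sphere intersected with the interior of \<open>P\<close> is relatively
      open, so it serves both as \<open>N\<close> and as \<open>O'\<close>.\<close>
    then show "\<exists>N \<subseteq> sphere 0 \<epsilon>.
        (\<exists>O'. openin (top_of_set (sphere 0 \<epsilon>)) O' \<and> sphere 0 \<epsilon> \<inter> ?V \<subseteq> O' \<and> O' \<subseteq> N) \<and>
        (\<forall>x \<in> N - ?V. transverse_at (sphere 0 \<epsilon>) {y\<in>U. G y = G x} x)"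
      using interior_subset[of P]
      by (intro exI[of _ "sphere 0 \<epsilon> \<inter> interior P"] conjI openin_open_Int) (auto simp: P_def)
  qed
qed

end
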